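(* Let $i\ge 0$, let $K$ be a finite abstract simplicial complex, $\Sigma$ an $i$-motif of $K$, and let $n$ be the number of $i$-simplices in $\operatorname{St}\Sigma$. Then there exist $n$ linearly independent functions $f_1,\dots,f_n\in C^i(K,\mathbb{R})$ and real numbers $\lambda_1,\dots,\lambda_n$ satisfying $$\Delta_i^{up}(K)f_j([F])=\lambda_jf_j([F])\quad\text{for every }i\text{-simplex }F\in\operatorname{St}\Sigma,$$ such that the complex $K^\Sigma$ obtained from $K$ by duplicating $\Sigma$ has $\lambda_1,\dots,\lambda_n$ as eigenvalues of $\Delta_i^{up}(K^\Sigma)$, with eigenfunctions $g_j$ which agree with $f_j$ on $\operatorname{St}\Sigma$, with $-f_j$ on $\operatorname{St}\Sigma'$ (transported via the isomorphism $v'_l\mapsto v_l$), and are zero elsewhere.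
   Context: For a finite abstract simplicial complex $K$ (closed under inclusion, containing the empty face), $S_i(K)$ is the set of $i$-faces and $C^i(K,\mathbb{R})$ is the space of real functions on oriented $i$-faces that change sign when the orientation is reversed. The coboundary $\delta_i:C^i\to C^{i+1}$ is $(\delta_i f)([v_0,\dots,v_{i+1}])=\sum_{j}(-1)^j f([v_0,\dots,\hat v_j,\dots,v_{i+1}])$. A positive weight function $w$ on faces defines inner products $(f,g)_{C^i}=\sum_{F\in S_i(K)}w(F)f([F])g([F])$, with adjoint $\delta_i^*$. The degree of an $i$-face is $\deg F=\sum_{\bar F\in S_{i+1}(K),\,F\subset\bar F}w(\bar F)$. The normalized combinatorial Laplacian is $\Delta_i^{up}(K)=\delta_i^*\delta_i$ on $C^i(K,\mathbb{R})$ for the weight function with $w(F)=1$ for every facet (inclusion-maximal face) and $w(F)=\deg F$ for every other face. For a collection $S$ of nonempty simplices of $K$: the closure $\operatorname{Cl}S$ is the smallest subcomplex containing $S$; the star $\operatorname{St}S$ is the set of simplices of $K$ having a (nonempty) face in $S$; the link is $\operatorname{lk}S=\operatorname{Cl}\operatorname{St}S-\operatorname{St}\operatorname{Cl}S$. An $i$-motif $\Sigma$ of $K$ is a subcomplex on vertices $v_0,\dots,v_k$ containing all faces of $K$ on those vertices (full subcomplex), with $\dim\operatorname{lk}\Sigma=i$. Let $u_1,\dots,u_m$ be the vertices of $\operatorname{lk}\Sigma$, and let $\Sigma'$ be a copy of $\Sigma$ on new vertices $v_0',\dots,v_k'$, isomorphic to $\Sigma$ via $v'_l\mapsto v_l$.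 The duplication of $\Sigma$ produces the complex $K^\Sigma=K\cup\{\{v'_{i_0},\dots,v'_{i_l},u_{j_1},\dots,u_{j_s}\}\mid\{v_{i_0},\dots,v_{i_l},u_{j_1},\dots,u_{j_s}\}\in K\}$; $\operatorname{St}\Sigma'$ is taken in $K^\Sigma$. *)

theory Defs
  imports Complex_Main "HOL-Combinatorics.Permutations"
begin

definition simplicial_complex :: "'a set set \<Rightarrow> bool" where
  "simplicial_complex K \<longleftrightarrow>
     finite K \<and> (\<forall>F\<in>K. finite F) \<and> {} \<in> K \<and> (\<forall>F\<in>K. \<forall>G. G \<subseteq> F \<longrightarrow> G \<in> K)"

definition subcomplex :: "'a set set \<Rightarrow> 'a set set \<Rightarrow> bool" where
  "subcomplex L K \<longleftrightarrow> simplicial_complex L \<and> L \<subseteq> K"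

definition faces :: "'a set set \<Rightarrow> nat \<Rightarrow> 'a set set" where
  "faces K i = {F \<in> K. card F = i + 1}"

definition complex_dim :: "'a set set \<Rightarrow> int" where
  "complex_dim K = Max ((\<lambda>F. int (card F) - 1) ` K)"

definition facet :: "'a set set \<Rightarrow> 'a set \<Rightarrow> bool" where
  "facet K F \<longleftrightarrow> F \<in> K \<and> (\<forall>G\<in>K. F \<subseteq> G \<longrightarrow> G = F)"


text \<open>
  An oriented face \<open>[v\<^sub>0, \<dots>, v\<^sub>i]\<close> is represented by the list of its vertices. A function on
  oriented faces that changes sign under reversal of the orientation is then a function on
  these lists that is multiplied by the sign of any permutation of the vertices. Cochains are
  set to zero on all other lists, so that equality of cochains is equality of functions.
\<close>

definition oriented_faces :: "'a set set \<Rightarrow> nat \<Rightarrow> 'a list set" where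
  "oriented_faces K i = {xs. distinct xs \<and> set xs \<in> faces K i}"

definition cochains :: "'a set set \<Rightarrow> nat \<Rightarrow> ('a list \<Rightarrow> real) set" where
  "cochains K i = {f.
     (\<forall>xs p. xs \<in> oriented_faces K i \<and> p permutes {..<length xs} \<longrightarrow>
        f (permute_list p xs) = of_int (sign p) * f xs) \<and>
     (\<forall>xs. xs \<notin> oriented_faces K i \<longrightarrow> f xs = 0)}"

definition coboundary :: "'a set set \<Rightarrow> nat \<Rightarrow> ('a list \<Rightarrow> real) \<Rightarrow> 'a list \<Rightarrow> real" where
  "coboundary K i f xs =
     (if xs \<in> oriented_faces K (i + 1)
      then \<Sum>j\<le>i + 1. (- 1) ^ j * f (take j xs @ drop (Suc j) xs) else 0)"

text \<open>
  An arbitrary orientation of a face; the products in the inner product below do not depend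
  on the choice.
\<close>

definition orient :: "'a set \<Rightarrow> 'a list" where
  "orient F = (SOME xs. distinct xs \<and> set xs = F)"

definition inner_cochains ::
  "('a set \<Rightarrow> real) \<Rightarrow> 'a set set \<Rightarrow> nat \<Rightarrow> ('a list \<Rightarrow> real) \<Rightarrow> ('a list \<Rightarrow> real) \<Rightarrow> real" where
  "inner_cochains w K i f g = (\<Sum>F\<in>faces K i. w F * f (orient F) * g (orient F))"

definition coboundary_adj ::
  "('a set \<Rightarrow> real) \<Rightarrow> 'a set set \<Rightarrow> nat \<Rightarrow> ('a list \<Rightarrow> real) \<Rightarrow> 'a list \<Rightarrow> real" where
  "coboundary_adj w K i g =
     (THE h. h \<in> cochains K i \<and>
        (\<forall>f\<in>cochains K i.
           inner_cochains w K (i + 1) (coboundary K i f) g = inner_cochains w K i f h))"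

definition face_degree :: "'a set set \<Rightarrow> ('a set \<Rightarrow> real) \<Rightarrow> 'a set \<Rightarrow> real" where
  "face_degree K w F = (\<Sum>G\<in>{G\<in>K. card G = card F + 1 \<and> F \<subset> G}. w G)"

lemma face_degree_cong [fundef_cong]:
  assumes "K = K'" "F = F'" "\<And>G. G \<in> K' \<Longrightarrow> F' \<subset> G \<Longrightarrow> w G = w' G"
  shows "face_degree K w F = face_degree K' w' F'"
  using assms unfolding face_degree_def by (auto intro!: sum.cong)

text \<open>
  The weight function of the normalized Laplacian: it is determined by downward recursion
  from the facets. The guard and the value \<open>0\<close> off \<open>K\<close> only serve termination and totality.
\<close>

function normalized_weight :: "'a set set \<Rightarrow> 'a set \<Rightarrow> real" where
  "normalized_weight K F =
     (if finite K \<and> F \<in> K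
      then if facet K F then 1 else face_degree K (normalized_weight K) F
      else 0)"
  by pat_completeness auto
termination
proof (relation "measure (\<lambda>(K, F). card {G \<in> K. F \<subset> G})", goal_cases)
  case (2 K F G)
  then have "{H \<in> K. G \<subset> H} \<subset> {H \<in> K. F \<subset> H}" by auto
  with 2 show ?case by (auto intro!: psubset_card_mono)
qed simp

declare normalized_weight.simps [simp del]

definition up_laplacian :: "'a set set \<Rightarrow> nat \<Rightarrow> ('a list \<Rightarrow> real) \<Rightarrow> 'a list \<Rightarrow> real" where
  "up_laplacian K i f = coboundary_adj (normalized_weight K) K i (coboundary K i f)"

definition eigenfunction_up_laplacian ::
  "'a set set \<Rightarrow> nat \<Rightarrow> real \<Rightarrow> ('a list \<Rightarrow> real) \<Rightarrow> bool" where
  "eigenfunction_up_laplacian K i c g \<longleftrightarrow>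
     g \<in> cochains K i \<and> g \<noteq> (\<lambda>_. 0) \<and> up_laplacian K i g = (\<lambda>xs. c * g xs)"

definition linearly_independent :: "nat \<Rightarrow> (nat \<Rightarrow> 'b \<Rightarrow> real) \<Rightarrow> bool" where
  "linearly_independent n f \<longleftrightarrow>
     (\<forall>c. (\<forall>x. (\<Sum>j<n. c j * f j x) = 0) \<longrightarrow> (\<forall>j<n. c j = 0))"


definition closure_in :: "'a set set \<Rightarrow> 'a set set \<Rightarrow> 'a set set" where
  "closure_in K S = \<Inter>{L. subcomplex L K \<and> S \<subseteq> L}"

text \<open>
  The condition \<open>G \<noteq> {}\<close> allows \<open>S\<close> to be a complex, whose empty face is to be ignored.
\<close>

definition star :: "'a set set \<Rightarrow> 'a set set \<Rightarrow> 'a set set" where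
  "star K S = {F \<in> K. \<exists>G\<in>S. G \<noteq> {} \<and> G \<subseteq> F}"

definition link :: "'a set set \<Rightarrow> 'a set set \<Rightarrow> 'a set set" where
  "link K S = closure_in K (star K S) - star K (closure_in K S)"

definition motif :: "'a set set \<Rightarrow> nat \<Rightarrow> 'a set set \<Rightarrow> bool" where
  "motif K i \<Sigma> \<longleftrightarrow>
     subcomplex \<Sigma> K \<and> (\<forall>F\<in>K. F \<subseteq> \<Union>\<Sigma> \<longrightarrow> F \<in> \<Sigma>) \<and> complex_dim (link K \<Sigma>) = int i"

text \<open>
  The new vertices form a set \<open>V'\<close> disjoint from the vertices of \<open>K\<close>, and \<open>\<rho>\<close> is the bijection
  \<open>v'\<^sub>l \<mapsto> v\<^sub>l\<close> onto the vertices of the motif; \<open>unprime\<close> extends it by the identity.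
\<close>

definition new_vertices ::
  "'a set set \<Rightarrow> 'a set set \<Rightarrow> 'a set \<Rightarrow> ('a \<Rightarrow> 'a) \<Rightarrow> bool" where
  "new_vertices K \<Sigma> V' \<rho> \<longleftrightarrow> V' \<inter> \<Union>K = {} \<and> bij_betw \<rho> V' (\<Union>\<Sigma>)"

definition unprime :: "'a set \<Rightarrow> ('a \<Rightarrow> 'a) \<Rightarrow> 'a \<Rightarrow> 'a" where
  "unprime V' \<rho> x = (if x \<in> V' then \<rho> x else x)"

definition motif_copy :: "'a set set \<Rightarrow> 'a set \<Rightarrow> ('a \<Rightarrow> 'a) \<Rightarrow> 'a set set" where
  "motif_copy \<Sigma> V' \<rho> = {F. F \<subseteq> V' \<and> \<rho> ` F \<in> \<Sigma>}"

definition duplication ::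
  "'a set set \<Rightarrow> 'a set set \<Rightarrow> 'a set \<Rightarrow> ('a \<Rightarrow> 'a) \<Rightarrow> 'a set set" where
  "duplication K \<Sigma> V' \<rho> =
     K \<union> {F. F \<subseteq> V' \<union> \<Union>(link K \<Sigma>) \<and> unprime V' \<rho> ` F \<in> K}"

end

theory Submission
  imports Defs "HOL-Analysis.Function_Topology"
begin

text \<open>
  The functions \<open>f\<^sub>j\<close> are the eigenvectors of the compression of the Laplacian of \<open>K\<close> to the cochains
  supported on the star of the motif; this compression is self-adjoint, so the spectral theorem
  provides \<open>n\<close> of them. No face of the duplicated complex meets both the motif and its copy, and
  near each of the two the duplicated complex looks, including weights, like \<open>K\<close> near the motif.
  Hence \<open>g\<^sub>j\<close> satisfies the eigenvalue equation on both stars. On a face outside both stars, the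
  contributions of the cofaces in one star cancel those of their mirror images in the other.
\<close>

section \<open>Spectral theorem for weighted symmetric matrices\<close>

text \<open>Testing the adjoint on elementary cochains gives \<open>up_laplacian_eq\<close>: the
  weight of a face times the value of the Laplacian there is a sum over its cofaces. This identity
  makes the compression symmetric in the weighted sense and makes the Laplacian local. Weights are
  local too: they are determined by the faces above a face, and a star contains every face above its
  members. The obstacle is that no global transport exists. \<open>unprime\<close> identifies a new
  vertex with its original, so it is injective only away from the vertices of \<Sigma>, and faces
  outside the stars may gain cofaces and change weight. The transfer lemmas therefore speak of
  upward closed parts only. On faces outside both stars both sides of the eigenvalue equation
  vanish, so there only the positivity of the new weight matters. The functions and eigenvalues are
  built from K and \<Sigma> alone, so one family serves every choice of new vertices.\<close>

lemma bounded_coordinates_compact: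
  fixes r :: "'b \<Rightarrow> real"
  shows "compact {x. \<forall>s. \<bar>x s\<bar> \<le> r s}"
proof -
  \<comment> \<open>Tychonoff's theorem for a product of intervals. The index type may be infinite;
    in the application \<open>r\<close> is 0 outside a finite set.\<close>
  have "compactin (product_topology (\<lambda>_. euclidean) UNIV) (PiE UNIV (\<lambda>s. {- r s..r s}))"
    unfolding compactin_PiE by auto
  moreover have "PiE UNIV (\<lambda>s. {- r s..r s}) = {x. \<forall>s. \<bar>x s\<bar> \<le> r s}"
    by (auto simp: PiE_def Pi_def abs_le_iff) (metis minus_le_iff)+
  ultimately show ?thesis
    by (simp add: euclidean_product_topology)
qed

text \<open>
  Induction on the number of eigenvectors found so far: the Rayleigh quotient attains its maximum on
  the unit sphere of their orthogonal complement, and a maximum point is a further eigenvector.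
\<close>

lemma orthonormal_eigenvectors:
  fixes w :: "'b \<Rightarrow> real" and M :: "'b \<Rightarrow> 'b \<Rightarrow> real"
  assumes S: "finite S" and w: "\<And>s. s \<in> S \<Longrightarrow> 0 < w s"
    and sym: "\<And>s t. s \<in> S \<Longrightarrow> t \<in> S \<Longrightarrow> M s t = M t s"
    and "k \<le> card S"
  shows "\<exists>x c. (\<forall>i<k. \<forall>j<k. (\<Sum>s\<in>S. w s * x i s * x j s) = (if i = j then 1 else 0)) \<and>
    (\<forall>j<k. \<forall>s\<in>S. (\<Sum>t\<in>S. M s t * x j t) = c j * w s * x j s)"
  using \<open>k \<le> card S\<close>
proof (induction k)
  case 0
  show ?case by simp
next
  case (Suc k)
  define ip where "ip x y = (\<Sum>s\<in>S. w s * x s * y s)" for x y :: "'b \<Rightarrow> real"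
  \<comment> \<open>Dividing by the weight turns the generalized eigenvalue problem M x = c w x into
    A x = c x, with \<open>A\<close> self-adjoint for \<open>ip\<close>.\<close>
  define A where "A x s = (\<Sum>t\<in>S. M s t * x t) / w s" for x s
  define q where "q x = ip x (A x)" for x
  from Suc.IH[OF Suc_leD[OF Suc.prems]] obtain x c
    where xc: "\<forall>i<k. \<forall>j<k. (\<Sum>s\<in>S. w s * x i s * x j s) = (if i = j then 1 else 0)"
      "\<forall>j<k. \<forall>s\<in>S. (\<Sum>t\<in>S. M s t * x j t) = c j * w s * x j s"
    by blast
  have x: "ip (x i) (x j) = (if i = j then 1 else 0)" if "i < k" "j < k" for i j
    using xc(1) that unfolding ip_def by blast
  have c: "(\<Sum>t\<in>S. M s t * x j t) = c j * w s * x j s" if "j < k" "s \<in> S" for j s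
    using xc(2) that by blast
  have ip_comm: "ip y z = ip z y" for y z
    by (simp add: ip_def mult_ac)
  have ip_add: "ip y (\<lambda>s. z s + t * u s) = ip y z + t * ip y u" for y z u t
    by (simp add: ip_def algebra_simps sum.distrib sum_distrib_left)
  have ip_add': "ip (\<lambda>s. z s + t * u s) y = ip z y + t * ip u y" for y z u t
    using ip_add ip_comm by metis
  have ip_pos: "0 \<le> ip y y" for y
    unfolding ip_def using w by (auto intro!: sum_nonneg simp: less_imp_le mult.assoc)
  have ip_0: "y s = 0" if "ip y y = 0" "s \<in> S" for y s
  proof -
    have "\<forall>s\<in>S. w s * y s * y s = 0"
      using that(1) S w unfolding ip_def
      by (subst (asm) sum_nonneg_eq_0_iff) (auto simp: less_imp_le mult.assoc)
    then show ?thesis using that w by fastforce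
  qed
  have A_add: "A (\<lambda>s. z s + t * u s) = (\<lambda>s. A z s + t * A u s)" for z u t
    by (rule ext)
      (simp add: A_def algebra_simps sum.distrib sum_distrib_left add_divide_distrib sum_divide_distrib)
  have A_sym: "ip y (A z) = ip (A y) z" for y z
  proof -
    have wA: "w s * A u s = (\<Sum>t\<in>S. M s t * u t)" if "s \<in> S" for u s
      using w[OF that] by (simp add: A_def)
    have "ip y (A z) = (\<Sum>s\<in>S. y s * (w s * A z s))"
      by (simp add: ip_def mult_ac)
    also have "\<dots> = (\<Sum>s\<in>S. \<Sum>t\<in>S. M s t * y s * z t)"
      by (simp add: wA sum_distrib_left mult_ac)
    also have "\<dots> = (\<Sum>t\<in>S. \<Sum>s\<in>S. M t s * y s * z t)"
      by (subst sum.swap) (simp add: sym)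
    also have "\<dots> = (\<Sum>t\<in>S. (w t * A y t) * z t)"
      by (simp add: wA sum_distrib_right)
    also have "\<dots> = ip (A y) z"
      by (simp add: ip_def)
    finally show ?thesis .
  qed
  have A_x: "ip (A (x j)) y = c j * ip (x j) y" if "j < k" for j y
  proof -
    have "ip (A (x j)) y = (\<Sum>s\<in>S. c j * (w s * x j s * y s))"
      unfolding ip_def
    proof (rule sum.cong)
      fix s assume "s \<in> S"
      with c[OF that this] w[OF this] show "w s * A (x j) s * y s = c j * (w s * x j s * y s)"
        by (simp add: A_def)
    qed simp
    then show ?thesis by (simp add: ip_def sum_distrib_left)
  qed
  define E where "E = {y. \<forall>j<k. ip (x j) y = 0}"
  \<comment> \<open>A dimension count by a trace: if the complement were null on S, each coordinate
    vector would equal its projection onto the k eigenvectors. Comparing diagonal entries and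
    summing over S gives \<open>card S = k\<close>, against
    \<open>Suc k \<le> card S\<close>.\<close>
  have "\<exists>y\<in>E. ip y y \<noteq> 0"
  proof (rule ccontr)
    assume none: "\<not> ?thesis"
    have ip_sum: "ip u (\<lambda>s. y s + (\<Sum>j<k. b j * x j s)) = ip u y + (\<Sum>j<k. b j * ip u (x j))" for u y b
    proof -
      have "ip u (\<lambda>s. y s + (\<Sum>j<k. b j * x j s)) =
         (\<Sum>s\<in>S. w s * u s * y s) + (\<Sum>s\<in>S. \<Sum>j<k. b j * (w s * u s * x j s))"
        by (simp add: ip_def algebra_simps sum.distrib sum_distrib_left)
      also have "\<dots> = ip u y + (\<Sum>j<k. b j * ip u (x j))"
        by (subst sum.swap) (simp add: ip_def sum_distrib_left)
      finally show ?thesis .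
    qed
    have parseval: "(\<Sum>j<k. w s * (x j s)^2) = 1" if "s \<in> S" for s
    proof -
      define d where "d t = (if t = s then 1 else 0 :: real)" for t
      have ip_d: "ip y d = w s * y s" for y
        using that S by (simp add: ip_def d_def if_distrib[of "(*) _"] cong: if_cong)
      \<comment> \<open>\<open>b j\<close> is minus the coefficient of \<open>d\<close> along
        \<open>x j\<close>, so that \<open>y\<close> is \<open>d\<close> minus its orthogonal
        projection.\<close>
      define b where "b j = - (w s * x j s)" for j
      define y where "y = (\<lambda>t. d t + (\<Sum>j<k. b j * x j t))"
      have orth: "ip (x i) y = 0" if "i < k" for i
      proof -
        have "(\<Sum>j<k. b j * ip (x i) (x j)) = (\<Sum>j<k. if i = j then b j else 0)"
          using that x by (intro sum.cong) auto
        then show ?thesis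
          using that unfolding y_def ip_sum ip_d by (simp add: b_def)
      qed
      then have "y \<in> E" by (simp add: E_def)
      then have "y s = 0" using none ip_0 that by auto
      then show ?thesis
        by (simp add: y_def d_def b_def sum_negf power2_eq_square mult_ac)
    qed
    have "real (card S) = (\<Sum>s\<in>S. \<Sum>j<k. w s * (x j s)^2)"
      by (simp add: parseval)
    also have "\<dots> = (\<Sum>j<k. ip (x j) (x j))"
      by (subst sum.swap) (simp add: ip_def power2_eq_square mult_ac)
    also have "\<dots> = real k"
      by (simp add: x)
    finally show False using Suc.prems by simp
  qed
  then obtain y where y: "y \<in> E" "ip y y \<noteq> 0" by blast
  \<comment> \<open>Pinning the coordinates outside S to 0 is what makes the unit sphere compact in
    the full function space.\<close>
  define C where "C = {z. (\<forall>s. s \<notin> S \<longrightarrow> z s = 0) \<and> ip z z = 1 \<and> (\<forall>j<k. ip (x j) z = 0)}"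
  have norm: "\<exists>a. a^2 * ip y y = 1 \<and> (\<lambda>s. if s \<in> S then a * y s else 0) \<in> C"
    if "y \<in> E" "ip y y \<noteq> 0" for y
  proof -
    define a where "a = 1 / sqrt (ip y y)"
    have a: "a^2 * ip y y = 1"
      using that ip_pos[of y] by (simp add: a_def power_divide)
    have r: "ip u (\<lambda>s. if s \<in> S then a * v s else 0) = a * ip u v" for u v
      by (simp add: ip_def sum_distrib_left mult_ac cong: sum.cong)
    define v where "v = (\<lambda>s. if s \<in> S then a * y s else 0)"
    have "ip v v = a * ip v y" by (simp add: v_def r)
    also have "ip v y = a * ip y y" by (simp only: ip_comm[of v y]) (simp add: v_def r)
    finally have "ip v v = a^2 * ip y y" by (simp add: power2_eq_square)
    then have "a^2 * ip y y = 1 \<and> v \<in> C"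
      using a that(1) by (auto simp: C_def E_def v_def r)
    then show ?thesis unfolding v_def by blast
  qed
  have cont_ip: "continuous_on UNIV (\<lambda>z. ip u z)" "continuous_on UNIV (\<lambda>z. ip z z)" for u
    unfolding ip_def by (intro continuous_intros continuous_on_product_coordinates)+
  have "compact C"
  proof -
    \<comment> \<open>The bound comes from the single term w s * (z s)^2 of the norm, which is at
      most 1.\<close>
    define r where "r s = (if s \<in> S then 1 / sqrt (w s) else 0)" for s
    have "C \<subseteq> {z. \<forall>s. \<bar>z s\<bar> \<le> r s}"
    proof clarify
      fix z s assume z: "z \<in> C"
      show "\<bar>z s\<bar> \<le> r s"
      proof (cases "s \<in> S")
        case True
        have "w s * z s * z s \<le> ip z z"
          unfolding ip_def using True S w
          by (intro member_le_sum) (auto simp: less_imp_le mult.assoc)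
        then have "w s * (z s)^2 \<le> 1" using z by (simp add: C_def power2_eq_square mult_ac)
        then have "(z s)^2 \<le> 1 / w s" using w[OF True] by (simp add: field_simps)
        then have "\<bar>z s\<bar> \<le> sqrt (1 / w s)" by (metis real_sqrt_abs real_sqrt_le_iff)
        then show ?thesis using True by (simp add: r_def real_sqrt_divide)
      qed (use z in \<open>simp add: C_def r_def\<close>)
    qed
    moreover have "closed C"
      unfolding C_def
      by (intro closed_Collect_conj closed_Collect_all closed_Collect_imp closed_Collect_eq
          open_Collect_const continuous_on_const continuous_on_product_coordinates cont_ip)
    ultimately show ?thesis
      using compact_Int_closed[OF bounded_coordinates_compact[of r], of C] by (simp add: Int_absorb1)
  qed
  moreover have "C \<noteq> {}" using norm[OF y] by blast
  moreover have "continuous_on C q"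
    unfolding q_def ip_def A_def
    by (rule continuous_on_subset[of UNIV])
      (auto simp: divide_inverse intro!: continuous_intros continuous_on_product_coordinates)
  ultimately obtain z where z: "z \<in> C" and max: "\<And>y. y \<in> C \<Longrightarrow> q y \<le> q z"
    using continuous_attains_sup by metis
  define l where "l = q z"
  \<comment> \<open>Homogeneity extends the maximum from the sphere to all of \<open>E\<close>, so
    that the variation below needs no normalization. Truncating to S changes neither
    \<open>ip\<close> nor \<open>q\<close>.\<close>
  have rayleigh: "q y \<le> l * ip y y" if "y \<in> E" for y
  proof (cases "ip y y = 0")
    case True
    then have "q y = 0"
      unfolding q_def ip_def using ip_0[OF True] by simp
    then show ?thesis using True by simp
  next
    case False
    from norm[OF that False] obtain a where a: "a^2 * ip y y = 1"
      "(\<lambda>s. if s \<in> S then a * y s else 0) \<in> C" by blast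
    have "q (\<lambda>s. if s \<in> S then a * y s else 0) = a^2 * q y"
      unfolding q_def ip_def A_def sum_distrib_left sum_divide_distrib power2_eq_square
      by (intro sum.cong refl) simp
    with max[OF a(2)] have "a^2 * q y \<le> l * (a^2 * ip y y)"
      by (simp add: l_def a(1))
    then have "a^2 * q y \<le> a^2 * (l * ip y y)" by (simp add: mult_ac)
    moreover have "0 < a^2" using a(1) by (cases "a = 0") auto
    ultimately show ?thesis by (simp only: mult_le_cancel_left_pos)
  qed
  have zE: "z \<in> E" and zz: "ip z z = 1" using z by (auto simp: C_def E_def)
  define u where "u s = A z s + (- l) * z s" for s
  have ip_u: "ip y u = ip y (A z) + (- l) * ip y z" for y
    unfolding u_def[abs_def] by (rule ip_add)
  \<comment> \<open>The residual \<open>u\<close> stays in \<open>E\<close> because a self-adjoint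
    \<open>A\<close> preserves the complement of its eigenvectors.\<close>
  have uE: "u \<in> E"
    using zE by (simp add: E_def ip_u A_sym A_x)
  \<comment> \<open>First variation at the maximum in the direction \<open>u\<close>: the gain is 2
    * t * ip u u up to a term quadratic in t, so it must vanish.\<close>
  have uu: "ip u u = 0"
  proof (rule ccontr)
    assume "ip u u \<noteq> 0"
    then have pos: "0 < ip u u" using ip_pos[of u] by simp
    have uAz: "ip u (A z) = ip u u + l * ip u z"
      using ip_u[of u] by simp
    have ineq: "2 * t * ip u u + t^2 * (q u - l * ip u u) \<le> 0" for t
    proof -
      have "(\<lambda>s. z s + t * u s) \<in> E"
        using zE uE by (auto simp: E_def ip_add)
      from rayleigh[OF this]
      have "q z + t * ip z (A u) + t * (ip u (A z) + t * q u)
          \<le> l * (ip z z + t * ip z u + t * (ip u z + t * ip u u))"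
        by (simp add: q_def A_add ip_add ip_add' algebra_simps)
      moreover have "ip z (A u) = ip u (A z)" using A_sym ip_comm by metis
      moreover have "ip z u = ip u z" using ip_comm .
      ultimately show ?thesis
        using uAz by (simp add: l_def[symmetric] zz algebra_simps power2_eq_square)
    qed
    \<comment> \<open>\<open>d\<close> is positive and dominates the quadratic coefficient. With t =
      ip u u / d the quadratic loss is at most half of the linear gain, which contradicts
      \<open>ineq\<close>.\<close>
    define d where "d = \<bar>q u - l * ip u u\<bar> + 1"
    have d: "0 < d" by (simp add: d_def)
    define t where "t = ip u u / d"
    have t: "0 < t" using pos d by (simp add: t_def)
    have "2 * t * ip u u \<le> t^2 * - (q u - l * ip u u)"
      using ineq[of t] by (simp add: algebra_simps)
    also have "\<dots> \<le> t^2 * d" by (intro mult_left_mono) (auto simp: d_def)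
    also have "\<dots> = t * ip u u" using d by (simp add: t_def power2_eq_square)
    finally show False using t pos by (simp add: mult_le_0_iff)
  qed
  have eig: "(\<Sum>t\<in>S. M s t * z t) = l * w s * z s" if "s \<in> S" for s
  proof -
    have "A z s = l * z s" using ip_0[OF uu that] by (simp add: u_def)
    then show ?thesis using w[OF that] by (simp add: A_def field_simps)
  qed
  have ipz: "ip (x j) z = 0" "ip z (x j) = 0" if "j < k" for j
    using zE that ip_comm by (auto simp: E_def)
  have "\<forall>i<Suc k. \<forall>j<Suc k. ip ((x(k := z)) i) ((x(k := z)) j) = (if i = j then 1 else 0)"
    by (auto simp: less_Suc_eq x zz ipz)
  moreover have "\<forall>j<Suc k. \<forall>s\<in>S.
      (\<Sum>t\<in>S. M s t * (x(k := z)) j t) = (c(k := l)) j * w s * (x(k := z)) j s"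
    by (auto simp: less_Suc_eq c eig)
  ultimately show ?case unfolding ip_def by blast
qed

section \<open>Alternating functions and cochains\<close>

text \<open>Adjacent exchanges generate all permutations, so this is the sign rule of
  \<open>cochains\<close> in its cheapest form. It mentions no complex and covers lists with
  repetitions, hence it passes between complexes unchanged.\<close>

definition alternating :: "('a list \<Rightarrow> real) \<Rightarrow> bool" where
  "alternating f \<longleftrightarrow> (\<forall>xs a b ys. f (xs @ a # b # ys) = - f (xs @ b # a # ys))"

text \<open>Moving \<open>a\<close> past \<open>ys\<close> takes one adjacent exchange for each
  entry of \<open>ys\<close>.\<close>

lemma alternating_move:
  assumes "alternating f"
  shows "f (xs @ a # ys @ zs) = (- 1) ^ length ys * f (xs @ ys @ a # zs)"
proof (induction ys arbitrary: xs)
  case (Cons y ys)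
  have "f (xs @ a # y # (ys @ zs)) = - f (xs @ y # a # (ys @ zs))"
    using assms unfolding alternating_def by blast
  then show ?case using Cons.IH[of "xs @ [y]"] by simp
qed simp

lemma alternating_swap:
  assumes "alternating f"
  shows "f (xs @ a # ys @ b # zs) = - f (xs @ b # ys @ a # zs)"
proof -
  have "f (xs @ a # ys @ b # zs) = (- 1) ^ length ys * f ((xs @ ys) @ a # b # zs)"
    using alternating_move[OF assms, of xs a ys "b # zs"] by simp
  also have "f ((xs @ ys) @ a # b # zs) = - f ((xs @ ys) @ b # a # zs)"
    using assms unfolding alternating_def by blast
  also have "(- 1) ^ length ys * - f ((xs @ ys) @ b # a # zs) = - f (xs @ b # ys @ a # zs)"
    using alternating_move[OF assms, of xs b ys "a # zs"] by simp
  finally show ?thesis .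
qed

lemma permute_list_transpose:
  "permute_list (transpose (length xs) (Suc (length xs + length ys))) (xs @ a # ys @ b # zs)
    = xs @ b # ys @ a # zs" (is "permute_list ?t ?L = ?R")
proof (rule nth_equalityI)
  have t: "?t permutes {..<length ?L}"
    by (rule permutes_swap_id) auto
  fix j assume j: "j < length (permute_list ?t ?L)"
  then have "permute_list ?t ?L ! j = ?L ! ?t j"
    by (intro permute_list_nth t) simp
  also have "\<dots> = ?R ! j"
    by (auto simp: transpose_def nth_append nth_Cons' )
  finally show "permute_list ?t ?L ! j = ?R ! j" .
qed simp

text \<open>Permutations are products of transpositions, and a transposition of two positions is
  handled by cutting the list there and applying \<open>alternating_swap\<close>.\<close>

lemma alternating_permute_list:
  assumes f: "alternating f" and "p permutes {..<length xs}"
  shows "f (permute_list p xs) = of_int (sign p) * f xs"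
proof -
  have swap: "f (permute_list (transpose a b) xs) = - f xs" if "a < b" "b < length xs" for a b xs
  proof -
    define P Q R where "P = take a xs" and "Q = take (b - Suc a) (drop (Suc a) xs)"
      and "R = drop (Suc b) xs"
    have "drop (Suc a) xs = Q @ xs ! b # R"
      using that id_take_nth_drop[of "b - Suc a" "drop (Suc a) xs"] by (simp add: Q_def R_def)
    then have xs: "xs = P @ xs ! a # Q @ xs ! b # R"
      using that id_take_nth_drop[of a xs] by (simp add: P_def)
    have "a = length P" "b = Suc (length P + length Q)"
      using that by (simp_all add: P_def Q_def)
    then have "permute_list (transpose a b) (P @ xs ! a # Q @ xs ! b # R) = P @ xs ! b # Q @ xs ! a # R"
      by (simp only: permute_list_transpose)
    then show ?thesis using xs alternating_swap[OF f] by metis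
  qed
  have "\<forall>xs. length xs = n \<longrightarrow> f (permute_list p xs) = of_int (sign p) * f xs"
    if "p permutes {..<n}" for n
    using that finite_lessThan
  proof (induction p rule: permutes_induct)
    case (swap a b p)
    show ?case
    proof (intro allI impI)
      fix xs :: "'a list" assume n: "length xs = n"
      have ab: "a < length xs" "b < length xs" using swap n by auto
      have neg: "f (permute_list (transpose a b) xs) = - f xs"
        using \<open>\<And>a b xs. a < b \<Longrightarrow> b < length xs \<Longrightarrow> f (permute_list (transpose a b) xs) = - f xs\<close>
          ab swap(3) by (metis nat_neq_iff transpose_commute)
      have "f (permute_list (transpose a b \<circ> p) xs) = f (permute_list p (permute_list (transpose a b) xs))"
        using swap n by (simp add: permute_list_compose)
      also have "\<dots> = - of_int (sign p) * f xs"
        using swap n neg by simp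
      also have "\<dots> = of_int (sign (transpose a b \<circ> p)) * f xs"
        using swap by (subst sign_compose)
          (auto simp: sign_swap_id permutation_swap_id intro: permutes_imp_permutation)
      finally show "f (permute_list (transpose a b \<circ> p) xs) = of_int (sign (transpose a b \<circ> p)) * f xs" .
    qed
  qed simp_all
  then show ?thesis using assms(2) by blast
qed

lemma alternating_if_permute_list:
  assumes "\<And>xs p. p permutes {..<length xs} \<Longrightarrow> f (permute_list p xs) = of_int (sign p) * f xs"
  shows "alternating f"
  unfolding alternating_def
proof (intro allI)
  fix xs ys :: "'a list" and a b
  let ?t = "transpose (length xs) (Suc (length xs))"
  have "f (permute_list ?t (xs @ a # b # ys)) = of_int (sign ?t) * f (xs @ a # b # ys)"
    by (intro assms permutes_swap_id) auto
  then show "f (xs @ a # b # ys) = - f (xs @ b # a # ys)"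
    using permute_list_transpose[of xs "[]" a b ys] by (simp add: sign_swap_id)
qed

lemma permute_list_oriented_faces:
  assumes "p permutes {..<length xs}"
  shows "permute_list p xs \<in> oriented_faces K i \<longleftrightarrow> xs \<in> oriented_faces K i"
  using assms by (simp add: oriented_faces_def)

text \<open>The definition asks for the sign rule on oriented faces only. Elsewhere it is automatic:
  permuting a list does not change whether it is an oriented face, so both sides are 0.\<close>

lemma cochains_iff:
  "f \<in> cochains K i \<longleftrightarrow> alternating f \<and> (\<forall>xs. xs \<notin> oriented_faces K i \<longrightarrow> f xs = 0)"
proof
  assume f: "f \<in> cochains K i"
  have "f (permute_list p xs) = of_int (sign p) * f xs" if "p permutes {..<length xs}" for p xs
    using f that permute_list_oriented_faces[OF that, of K i] unfolding cochains_def
    by (cases "xs \<in> oriented_faces K i") auto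
  with f show "alternating f \<and> (\<forall>xs. xs \<notin> oriented_faces K i \<longrightarrow> f xs = 0)"
    unfolding cochains_def by (auto intro: alternating_if_permute_list)
next
  assume "alternating f \<and> (\<forall>xs. xs \<notin> oriented_faces K i \<longrightarrow> f xs = 0)"
  then show "f \<in> cochains K i"
    unfolding cochains_def using alternating_permute_list by auto
qed

text \<open>
  Exchanging adjacent vertices at positions \<open>k\<close> and \<open>k + 1\<close> exchanges, up to sign, the two terms
  of the coboundary that omit them, and changes the sign of every other term.
\<close>

lemma alternating_coboundary:
  assumes f: "alternating f"
  shows "alternating (coboundary K i f)"
  unfolding alternating_def
proof (intro allI)
  fix xs ys :: "'a list" and a b
  define L L' where "L = xs @ a # b # ys" and "L' = xs @ b # a # ys"
  define t where "t L j = (- 1) ^ j * f (take j L @ drop (Suc j) L)" for L j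
  define k where "k = length xs"
  have mem: "L \<in> oriented_faces K (i + 1) \<longleftrightarrow> L' \<in> oriented_faces K (i + 1)"
    unfolding L_def L'_def oriented_faces_def by (auto simp: insert_commute)
  have omit: "t L (transpose k (Suc k) j) = - t L' j" if "j < length L" for j
  proof -
    consider "j < k" | "j = k" | "j = Suc k" | "Suc k < j" by linarith
    then show ?thesis
    proof cases
      case 1
      then have xs: "xs = take j xs @ xs ! j # drop (Suc j) xs"
        using id_take_nth_drop k_def by blast
      have "transpose k (Suc k) j = j" using 1 by (simp add: transpose_def)
      moreover have "f (take j xs @ drop (Suc j) xs @ a # b # ys)
          = - f (take j xs @ drop (Suc j) xs @ b # a # ys)"
        using f unfolding alternating_def by (metis append.assoc)
      ultimately show ?thesis using 1 by (simp add: t_def L_def L'_def k_def)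
    next
      case 2
      then show ?thesis by (simp add: t_def L_def L'_def k_def)
    next
      case 3
      then show ?thesis by (simp add: t_def L_def L'_def k_def)
    next
      case 4
      define m where "m = j - Suc (Suc k)"
      have j: "j = Suc (Suc (k + m))" using 4 by (simp add: m_def)
      have "transpose k (Suc k) j = j" using 4 by (simp add: transpose_def)
      moreover have "f (xs @ a # b # (take m ys @ drop (Suc m) ys))
          = - f (xs @ b # a # (take m ys @ drop (Suc m) ys))"
        using f unfolding alternating_def by blast
      ultimately show ?thesis by (simp add: t_def L_def L'_def k_def j numeral_3_eq_3)
    qed
  qed
  have "(\<Sum>j\<le>i + 1. t L j) = - (\<Sum>j\<le>i + 1. t L' j)" if "L \<in> oriented_faces K (i + 1)"
  proof -
    have len: "length L = i + 2"
      using that distinct_card[of L] by (auto simp: oriented_faces_def faces_def)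
    then have "transpose k (Suc k) permutes {..i + 1}"
      by (intro permutes_swap_id) (auto simp: L_def k_def)
    then have "(\<Sum>j\<le>i + 1. t L j) = (\<Sum>j\<le>i + 1. t L (transpose k (Suc k) j))"
      using sum.permute[of _ "{..i + 1}" "t L"] by (simp add: o_def)
    also have "\<dots> = (\<Sum>j\<le>i + 1. - t L' j)"
      using len by (intro sum.cong refl omit) auto
    finally show ?thesis by (simp add: sum_negf)
  qed
  then have "coboundary K i f L = - coboundary K i f L'"
    using mem by (simp add: coboundary_def t_def)
  then show "coboundary K i f (xs @ a # b # ys) = - coboundary K i f (xs @ b # a # ys)"
    by (simp add: L_def L'_def)
qed

section \<open>Reorientation signs and elementary cochains\<close>

lemma distinct_set_eq_permute_list:
  assumes "distinct xs" "distinct ys" "set xs = set ys"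
  obtains p where "p permutes {..<length xs}" "permute_list p xs = ys"
  using assms mset_eq_permutation[of ys xs] set_eq_iff_mset_eq_distinct by metis

text \<open>
  The elementary cochain of the oriented face \<open>xs\<close>; it is the zero function if \<open>xs\<close> has repeated vertices.
\<close>

definition perm_sign :: "'a list \<Rightarrow> 'a list \<Rightarrow> real" where
  "perm_sign xs ys = (if distinct xs \<and> distinct ys \<and> set xs = set ys
     then of_int (sign (THE p. p permutes {..<length xs} \<and> permute_list p xs = ys)) else 0)"

text \<open>Distinct entries leave only one candidate for the description in
  \<open>perm_sign\<close>: equal entries force equal positions, and outside the index range a
  permutation is the identity.\<close>

lemma perm_sign_eq_sign:
  assumes "distinct xs" "p permutes {..<length xs}"
  shows "perm_sign xs (permute_list p xs) = of_int (sign p)"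
proof -
  have "(THE q. q permutes {..<length xs} \<and> permute_list q xs = permute_list p xs) = p"
  proof (rule the_equality)
    fix q assume q: "q permutes {..<length xs} \<and> permute_list q xs = permute_list p xs"
    show "q = p"
    proof
      fix j
      show "q j = p j"
      proof (cases "j < length xs")
        case True
        then have "xs ! q j = xs ! p j" using q assms permute_list_nth by metis
        moreover have "q j < length xs" "p j < length xs"
          using True q assms(2) permutes_in_image by (metis lessThan_iff)+
        ultimately show ?thesis using assms(1) nth_eq_iff_index_eq by blast
      qed (use q assms(2) permutes_not_in in \<open>metis lessThan_iff\<close>)
    qed
  qed (use assms in auto)
  then show ?thesis using assms by (simp add: perm_sign_def)
qed

lemma perm_sign_permute_list:
  assumes q: "q permutes {..<length ys}"
  shows "perm_sign xs (permute_list q ys) = of_int (sign q) * perm_sign xs ys"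
proof (cases "distinct xs \<and> distinct ys \<and> set xs = set ys")
  case True
  then obtain p where p: "p permutes {..<length xs}" "permute_list p xs = ys"
    using distinct_set_eq_permute_list by blast
  have q': "q permutes {..<length xs}" using q p by auto
  have "permute_list q ys = permute_list (p \<circ> q) xs"
    using permute_list_compose[OF q'] p by metis
  moreover have "sign (p \<circ> q) = sign p * sign q"
    using p q' by (intro sign_compose) (auto intro: permutes_imp_permutation)
  ultimately show ?thesis
    using True perm_sign_eq_sign[of xs p] perm_sign_eq_sign[of xs "p \<circ> q"] p permutes_compose[OF q' p(1)]
    by (simp add: mult.commute)
qed (use q in \<open>auto simp: perm_sign_def\<close>)

lemma alternating_perm_sign: "alternating (perm_sign xs)"
  by (rule alternating_if_permute_list, erule perm_sign_permute_list)

lemma perm_sign_self: "distinct xs \<Longrightarrow> perm_sign xs xs = 1"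
  using perm_sign_eq_sign[of xs id] by (simp add: permutes_id)

lemma perm_sign_eq_0: "set xs \<noteq> set ys \<Longrightarrow> perm_sign xs ys = 0"
  by (simp add: perm_sign_def)

lemma alternating_reorient:
  assumes "alternating f" "distinct xs" "distinct ys" "set xs = set ys"
  shows "f ys = perm_sign xs ys * f xs"
proof -
  obtain p where "p permutes {..<length xs}" "permute_list p xs = ys"
    using distinct_set_eq_permute_list assms by blast
  then show ?thesis
    using alternating_permute_list[OF assms(1), of p xs] perm_sign_eq_sign[OF assms(2), of p] by auto
qed

lemma perm_sign_square:
  assumes "distinct xs" "distinct ys" "set xs = set ys"
  shows "perm_sign xs ys * perm_sign xs ys = 1"
  using assms by (simp add: perm_sign_def flip: of_int_mult)

text \<open>Reorienting there and back gives 1, so the two signs are inverse to each other, and each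
  sign is its own inverse.\<close>

lemma perm_sign_commute: "perm_sign xs ys = perm_sign ys xs"
proof (cases "distinct xs \<and> distinct ys \<and> set xs = set ys")
  case True
  then have "perm_sign xs ys * (perm_sign xs ys * perm_sign ys xs) = perm_sign xs ys"
    using alternating_reorient[OF alternating_perm_sign, of xs ys ys] by (simp add: perm_sign_self)
  then show ?thesis using perm_sign_square True by (metis mult.assoc mult_1)
qed (auto simp: perm_sign_def)

lemma perm_sign_permute_list_left:
  assumes "p permutes {..<length xs}"
  shows "perm_sign (permute_list p xs) = (\<lambda>ys. of_int (sign p) * perm_sign xs ys)"
  by (rule ext) (metis perm_sign_permute_list[OF assms] perm_sign_commute)

text \<open>An injective relabelling of vertices keeps the positions and hence the reordering
  permutation. This carries elementary cochains along \<open>unprime\<close>.\<close>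

lemma perm_sign_map:
  assumes "inj_on h (set xs \<union> set ys)"
  shows "perm_sign (map h xs) (map h ys) = perm_sign xs ys"
proof (cases "distinct xs \<and> distinct ys \<and> set xs = set ys")
  case True
  then obtain p where p: "p permutes {..<length xs}" "permute_list p xs = ys"
    using distinct_set_eq_permute_list by blast
  then have "map h ys = permute_list p (map h xs)" by (simp add: permute_list_map)
  moreover have "distinct (map h xs)" using True assms by (simp add: distinct_map)
  ultimately show ?thesis
    using True p perm_sign_eq_sign[of xs p] perm_sign_eq_sign[of "map h xs" p] by simp
next
  case False
  have "distinct (map h xs) \<longleftrightarrow> distinct xs" "distinct (map h ys) \<longleftrightarrow> distinct ys"
    using inj_on_subset[OF assms] by (auto simp: distinct_map)
  moreover have "h ` set xs = h ` set ys \<longleftrightarrow> set xs = set ys"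
    using inj_on_image_eq_iff[OF assms] by auto
  ultimately show ?thesis using False unfolding perm_sign_def by auto
qed

lemma perm_sign_cochain:
  assumes "xs \<in> oriented_faces K i"
  shows "perm_sign xs \<in> cochains K i"
  using assms unfolding cochains_iff
  by (auto simp: alternating_perm_sign) (auto simp: perm_sign_def oriented_faces_def)

lemma orient:
  assumes "finite F"
  shows "distinct (orient F)" "set (orient F) = F"
proof -
  have "\<exists>xs. distinct xs \<and> set xs = F"
    using finite_distinct_list[OF assms] by blast
  from someI_ex[OF this] show "distinct (orient F)" "set (orient F) = F"
    by (simp_all add: orient_def)
qed

text \<open>The reorientation sign enters twice. This is needed because \<open>orient\<close> is an
  arbitrary choice that does not commute with vertex maps.\<close>

lemma alternating_mult_cong:
  assumes "alternating f" "alternating g" "distinct xs" "distinct ys" "set xs = set ys"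
  shows "f xs * g xs = f ys * g ys"
proof -
  have "f ys * g ys = (perm_sign xs ys * perm_sign xs ys) * (f xs * g xs)"
    using alternating_reorient[OF assms(1,3-5)] alternating_reorient[OF assms(2,3-5)] by simp
  then show ?thesis using perm_sign_square[OF assms(3-5)] by simp
qed

lemma coboundary_scale: "coboundary K i (\<lambda>ys. a * f ys) zs = a * coboundary K i f zs"
  by (simp add: coboundary_def sum_distrib_left mult_ac del: sum.atMost_Suc)

lemma coboundary_sum:
  "coboundary K i (\<lambda>ys. \<Sum>F\<in>S. x F * e F ys) zs = (\<Sum>F\<in>S. x F * coboundary K i (e F) zs)"
proof (cases "zs \<in> oriented_faces K (i + 1)")
  case True
  then show ?thesis
    unfolding coboundary_def
    by (simp add: sum_distrib_left del: sum.atMost_Suc)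
      (subst sum.swap, simp add: mult_ac del: sum.atMost_Suc)
qed (simp add: coboundary_def)

section \<open>The Laplacian\<close>

text \<open>Only the nonemptiness of the degree sum needs an argument: a face strictly above F may
  be too large, but adding to F a single vertex of it gives a coface of the right size.\<close>

lemma normalized_weight_pos:
  assumes "simplicial_complex K" "F \<in> K"
  shows "0 < normalized_weight K F"
  using assms
proof (induction K F rule: normalized_weight.induct)
  case (1 K F)
  have K: "finite K" using 1 by (simp add: simplicial_complex_def)
  show ?case
  proof (cases "facet K F")
    case True
    show ?thesis using K "1.prems"(2) True by (subst normalized_weight.simps) simp
  next
    case False
    then obtain G where "G \<in> K" "F \<subset> G" using 1 unfolding facet_def by blast
    then obtain v where "v \<in> G" "v \<notin> F" by blast
    then have "insert v F \<subseteq> G" using \<open>F \<subset> G\<close> by blast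
    then have vF: "insert v F \<in> K"
      using "1.prems" \<open>G \<in> K\<close> unfolding simplicial_complex_def by blast
    have "finite F"
      using "1.prems" unfolding simplicial_complex_def by blast
    then have card: "card (insert v F) = card F + 1" using \<open>v \<notin> F\<close> by simp
    have pos: "0 < normalized_weight K G" if "G \<in> K" "F \<subset> G" for G
      using "1.IH"[of G] that "1.prems" K False by blast
    then have "0 < face_degree K (normalized_weight K) F"
      unfolding face_degree_def
    proof (intro sum_pos)
      show "{G \<in> K. card G = card F + 1 \<and> F \<subset> G} \<noteq> {}"
        using vF card \<open>v \<notin> F\<close> by blast
    qed (use K pos in auto)
    then show ?thesis using K "1.prems"(2) False by (subst normalized_weight.simps) simp
  qed
qed

context
  fixes K :: "'a set set" and i :: nat
  assumes K: "simplicial_complex K"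
begin

lemma finite_faces: "finite (faces K i)"
  using K by (simp add: faces_def simplicial_complex_def)

lemma orient_faces:
  assumes "F \<in> faces K i"
  shows "distinct (orient F)" "set (orient F) = F" "orient F \<in> oriented_faces K i"
  using K assms orient[of F] by (auto simp: simplicial_complex_def faces_def oriented_faces_def)

lemma perm_sign_orient:
  assumes "F \<in> faces K i" "G \<in> faces K i"
  shows "perm_sign (orient F) (orient G) = (if F = G then 1 else 0)"
  using orient_faces assms by (auto simp: perm_sign_self perm_sign_eq_0)

text \<open>Elementary cochains form a basis: at any oriented face only the summand of its own
  vertex set survives. Hence the adjoint equation needs to be tested on them only.\<close>

lemma cochain_expansion:
  assumes f: "f \<in> cochains K i"
  shows "f ys = (\<Sum>F\<in>faces K i. f (orient F) * perm_sign (orient F) ys)"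
proof (cases "ys \<in> oriented_faces K i")
  case True
  then have ys: "distinct ys" "set ys \<in> faces K i" by (auto simp: oriented_faces_def)
  have "(\<Sum>F\<in>faces K i. f (orient F) * perm_sign (orient F) ys)
      = (\<Sum>F\<in>faces K i. if F = set ys then f (orient F) * perm_sign (orient F) ys else 0)"
    using orient_faces by (intro sum.cong) (auto simp: perm_sign_eq_0)
  also have "\<dots> = f (orient (set ys)) * perm_sign (orient (set ys)) ys"
    using ys finite_faces by simp
  also have "\<dots> = f ys"
    using alternating_reorient[of f "orient (set ys)" ys] f ys orient_faces[of "set ys"]
    by (simp add: cochains_iff)
  finally show ?thesis by simp
next
  case False
  then have "perm_sign (orient F) ys = 0" if "F \<in> faces K i" for F
    using that orient_faces[OF that] perm_sign_cochain[of "orient F" K i] by (simp add: cochains_iff)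
  with False f show ?thesis by (simp add: cochains_iff)
qed

lemma inner_perm_sign:
  assumes "F \<in> faces K i"
  shows "inner_cochains w K i (perm_sign (orient F)) h = w F * h (orient F)"
proof -
  have "inner_cochains w K i (perm_sign (orient F)) h
      = (\<Sum>G\<in>faces K i. if F = G then w F * h (orient F) else 0)"
    unfolding inner_cochains_def using assms by (intro sum.cong) (auto simp: perm_sign_orient)
  then show ?thesis using assms finite_faces by simp
qed

text \<open>The formula is the value that the adjoint equation forces when tested on the elementary
  cochain of \<open>xs\<close>. It obeys the sign rule because that cochain changes sign with
  \<open>xs\<close>.\<close>

lemma coboundary_adj_cochain:
  "(\<lambda>xs. if xs \<in> oriented_faces K i
    then inner_cochains w K (i + 1) (coboundary K i (perm_sign xs)) g / w (set xs) else 0)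
    \<in> cochains K i" (is "?h \<in> _")
proof -
  have "?h (permute_list p xs) = of_int (sign p) * ?h xs" if p: "p permutes {..<length xs}" for p xs
  proof (cases "xs \<in> oriented_faces K i")
    case True
    have "coboundary K i (perm_sign (permute_list p xs)) zs
        = of_int (sign p) * coboundary K i (perm_sign xs) zs" for zs
      unfolding perm_sign_permute_list_left[OF p] by (rule coboundary_scale)
    then show ?thesis
      using p permute_list_oriented_faces[OF p]
      by (simp add: inner_cochains_def sum_distrib_left mult_ac)
  qed (use p permute_list_oriented_faces[OF p] in simp)
  then show ?thesis
    unfolding cochains_iff by (auto intro!: alternating_if_permute_list)
qed

text \<open>Existence: the adjoint equation is linear in the test cochain, hence follows from its
  elementary cases. Uniqueness: these cases already fix the value at each oriented face, since the
  weights do not vanish.\<close>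

lemma coboundary_adj_eq:
  assumes w: "\<And>F. F \<in> faces K i \<Longrightarrow> w F \<noteq> 0"
  shows "coboundary_adj w K i g = (\<lambda>xs. if xs \<in> oriented_faces K i
    then inner_cochains w K (i + 1) (coboundary K i (perm_sign xs)) g / w (set xs) else 0)"
    (is "_ = ?h")
  unfolding coboundary_adj_def
proof (rule the_equality)
  note hc = coboundary_adj_cochain[of w g]
  have "inner_cochains w K (i + 1) (coboundary K i f) g = inner_cochains w K i f ?h"
    if f: "f \<in> cochains K i" for f
  proof -
    have "f = (\<lambda>ys. \<Sum>F\<in>faces K i. f (orient F) * perm_sign (orient F) ys)"
      using cochain_expansion[OF f] by (rule ext)
    from trans[OF arg_cong[OF this, of "\<lambda>h. coboundary K i h _"] coboundary_sum]
    have d: "coboundary K i f zs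
        = (\<Sum>F\<in>faces K i. f (orient F) * coboundary K i (perm_sign (orient F)) zs)" for zs .
    have "inner_cochains w K (i + 1) (coboundary K i f) g = (\<Sum>G\<in>faces K (i + 1). \<Sum>F\<in>faces K i.
        f (orient F) * (w G * coboundary K i (perm_sign (orient F)) (orient G) * g (orient G)))"
      unfolding inner_cochains_def d sum_distrib_left sum_distrib_right
      by (intro sum.cong refl) (simp only: mult_ac)
    also have "\<dots> = (\<Sum>F\<in>faces K i. f (orient F) *
        inner_cochains w K (i + 1) (coboundary K i (perm_sign (orient F))) g)"
      unfolding inner_cochains_def by (subst sum.swap) (simp add: sum_distrib_left)
    also have "\<dots> = inner_cochains w K i f ?h"
      unfolding inner_cochains_def[of w K i] using w orient_faces by (intro sum.cong) auto
    finally show ?thesis .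
  qed
  with hc show "?h \<in> cochains K i \<and> (\<forall>f\<in>cochains K i.
      inner_cochains w K (i + 1) (coboundary K i f) g = inner_cochains w K i f ?h)" by blast
  fix h assume h: "h \<in> cochains K i \<and> (\<forall>f\<in>cochains K i.
      inner_cochains w K (i + 1) (coboundary K i f) g = inner_cochains w K i f h)"
  have "h (orient F) = ?h (orient F)" if F: "F \<in> faces K i" for F
  proof -
    have "w F * h (orient F) = inner_cochains w K (i + 1) (coboundary K i (perm_sign (orient F))) g"
      using h perm_sign_cochain[OF orient_faces(3)[OF F]] by (simp add: inner_perm_sign[OF F])
    then show ?thesis
      using w[OF F] orient_faces[OF F] by (auto simp: field_simps)
  qed
  then have eq: "(\<Sum>F\<in>faces K i. h (orient F) * perm_sign (orient F) ys)
      = (\<Sum>F\<in>faces K i. ?h (orient F) * perm_sign (orient F) ys)" for ys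
    by (intro sum.cong refl arg_cong2[where f = "(*)"]) blast
  have "h ys = ?h ys" for ys
    by (rule trans[OF cochain_expansion trans[OF eq cochain_expansion[OF hc, symmetric]]]) (use h in blast)
  then show "h = ?h" by (rule ext)
qed

text \<open>Multiplying by the weight leaves a symmetric pairing of coboundaries, to which only
  faces containing \<open>set xs\<close> can contribute. Both the spectral step and the local
  comparison of complexes start from here.\<close>

lemma up_laplacian_eq:
  assumes "xs \<in> oriented_faces K i"
  shows "normalized_weight K (set xs) * up_laplacian K i f xs
    = inner_cochains (normalized_weight K) K (i + 1) (coboundary K i (perm_sign xs)) (coboundary K i f)"
proof -
  have "normalized_weight K F \<noteq> 0" if "F \<in> faces K i" for F
    using normalized_weight_pos[OF K, of F] that by (simp add: faces_def)
  moreover have "set xs \<in> faces K i" using assms by (simp add: oriented_faces_def)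
  ultimately show ?thesis
    using assms by (simp add: up_laplacian_def coboundary_adj_eq)
qed

lemma up_laplacian_cochain: "up_laplacian K i f \<in> cochains K i"
proof -
  have "normalized_weight K F \<noteq> 0" if "F \<in> faces K i" for F
    using normalized_weight_pos[OF K, of F] that by (simp add: faces_def)
  then show ?thesis
    using coboundary_adj_cochain by (simp add: up_laplacian_def coboundary_adj_eq)
qed

end

text \<open>The compression to S has as its matrix the Gram matrix \<open>M\<close> of the
  coboundaries of elementary cochains, which is symmetric. Its weighted eigenvectors serve as
  coordinates of the f j. Nothing is claimed about the Laplacian outside S, where its values may be
  nonzero.\<close>

lemma eigenfunctions_on_faces:
  assumes K: "simplicial_complex K" and S: "S \<subseteq> faces K i"
  shows "\<exists>f c. (\<forall>j<card S. f j \<in> cochains K i \<and> (\<forall>xs. set xs \<notin> S \<longrightarrow> f j xs = 0)) \<and>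
    linearly_independent (card S) f \<and>
    (\<forall>j<card S. \<forall>xs\<in>oriented_faces K i. set xs \<in> S \<longrightarrow> up_laplacian K i (f j) xs = c j * f j xs)"
proof -
  let ?w = "normalized_weight K"
  define d where "d F = coboundary K i (perm_sign (orient F))" for F
  define M where "M F G = inner_cochains ?w K (i + 1) (d F) (d G)" for F G
  have fin: "finite S" using S finite_faces[OF K] finite_subset by blast
  have SK: "F \<in> K" "F \<in> faces K i" if "F \<in> S" for F
    using S that by (auto simp: faces_def)
  obtain x c where
    orth: "\<forall>j<card S. \<forall>k<card S. (\<Sum>F\<in>S. ?w F * x j F * x k F) = (if j = k then 1 else 0)"
    and eig: "\<forall>j<card S. \<forall>F\<in>S. (\<Sum>G\<in>S. M F G * x j G) = c j * ?w F * x j F"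
    using orthonormal_eigenvectors[OF fin, of ?w M "card S"] normalized_weight_pos[OF K] SK
    by (auto simp: M_def inner_cochains_def mult_ac)
  define f where "f j ys = (\<Sum>F\<in>S. x j F * perm_sign (orient F) ys)" for j :: nat and ys
  have f_orient: "f j (orient F) = x j F" if "F \<in> S" for j F
  proof -
    have "f j (orient F) = (\<Sum>G\<in>S. if G = F then x j G else 0)"
      unfolding f_def using that SK by (intro sum.cong refl) (simp add: perm_sign_orient[OF K SK(2) SK(2)])
    then show ?thesis using that fin by simp
  qed
  have "f j (permute_list p xs) = of_int (sign p) * f j xs" if "p permutes {..<length xs}" for j p xs
    unfolding f_def by (simp add: perm_sign_permute_list[OF that] sum_distrib_left mult_ac)
  then have alt: "alternating (f j)" for j by (rule alternating_if_permute_list) simp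
  have supp: "f j xs = 0" if "set xs \<notin> S" for j xs
  proof -
    have "perm_sign (orient F) xs = 0" if "F \<in> S" for F
      using orient_faces(2)[OF K SK(2)[OF that]] that \<open>set xs \<notin> S\<close> by (intro perm_sign_eq_0) auto
    then show ?thesis by (simp add: f_def)
  qed
  have coch: "f j \<in> cochains K i" for j
  proof -
    have "f j xs = 0" if "xs \<notin> oriented_faces K i" for xs
    proof -
      have "perm_sign (orient F) xs = 0" if "F \<in> S" for F
        using perm_sign_cochain[OF orient_faces(3)[OF K SK(2)[OF that]]] \<open>xs \<notin> _\<close>
        by (simp add: cochains_iff)
      then show ?thesis by (simp add: f_def)
    qed
    with alt show ?thesis by (simp add: cochains_iff)
  qed
  have "linearly_independent (card S) f"
    unfolding linearly_independent_def
  proof (intro allI impI)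
    fix b k assume 0: "\<forall>xs. (\<Sum>j<card S. b j * f j xs) = 0" and k: "k < card S"
    have z: "(\<Sum>j<card S. b j * x j F) = 0" if "F \<in> S" for F
      using 0[rule_format, of "orient F"] by (simp add: f_orient[OF that])
    \<comment> \<open>Pairing the relation with \<open>x k\<close> in the weighted inner product
      isolates \<open>b k\<close> by orthonormality.\<close>
    have "0 = (\<Sum>F\<in>S. ?w F * x k F * (\<Sum>j<card S. b j * x j F))"
      by (simp add: z)
    also have "\<dots> = (\<Sum>j<card S. b j * (\<Sum>F\<in>S. ?w F * x k F * x j F))"
      unfolding sum_distrib_left by (subst sum.swap) (simp add: mult_ac)
    also have "\<dots> = (\<Sum>j<card S. if j = k then b j else 0)"
      using orth k by (intro sum.cong) auto
    also have "\<dots> = b k" using k by simp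
    finally show "b k = 0" by simp
  qed
  moreover have "up_laplacian K i (f j) xs = c j * f j xs"
    if j: "j < card S" and xs: "xs \<in> oriented_faces K i" "set xs \<in> S" for j xs
  proof -
    define F where "F = set xs"
    have F: "F \<in> S" "F \<in> faces K i" using xs SK by (auto simp: F_def)
    have df: "coboundary K i (f j) zs = (\<Sum>G\<in>S. x j G * d G zs)" for zs
      unfolding d_def f_def[abs_def] by (rule coboundary_sum)
    have "?w F * up_laplacian K i (f j) (orient F)
        = inner_cochains ?w K (i + 1) (d F) (coboundary K i (f j))"
      using up_laplacian_eq[OF K orient_faces(3)[OF K F(2)], of "f j"] orient_faces(2)[OF K F(2)]
      by (simp add: d_def)
    also have "\<dots> = (\<Sum>H\<in>faces K (i + 1). \<Sum>G\<in>S. ?w H * d F (orient H) * d G (orient H) * x j G)"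
      unfolding inner_cochains_def df sum_distrib_left by (intro sum.cong refl) (simp only: mult_ac)
    also have "\<dots> = (\<Sum>G\<in>S. M F G * x j G)"
      by (subst sum.swap) (simp only: M_def inner_cochains_def sum_distrib_right)
    also have "\<dots> = c j * ?w F * x j F" using eig j F by blast
    finally have "?w F * up_laplacian K i (f j) (orient F) = ?w F * (c j * f j (orient F))"
      by (simp add: f_orient[OF F(1)])
    then have eq: "up_laplacian K i (f j) (orient F) = c j * f j (orient F)"
      using normalized_weight_pos[OF K SK(1)[OF F(1)]] by simp
    have o: "distinct (orient F)" "distinct xs" "set (orient F) = set xs"
      using orient_faces[OF K F(2)] xs by (auto simp: F_def oriented_faces_def)
    have "alternating (up_laplacian K i (f j))"
      using up_laplacian_cochain[OF K] by (simp add: cochains_iff)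
    from alternating_reorient[OF this o] alternating_reorient[OF alt o, of j] show ?thesis
      by (simp add: eq)
  qed
  ultimately show ?thesis using coch supp by blast
qed

section \<open>Transfer between complexes\<close>

text \<open>A weight is computed from the faces above, and upward closure keeps all of these inside
  \<open>T\<close> and \<open>T'\<close>, where \<open>h\<close> preserves inclusion and size. The
  induction runs over the number of faces strictly above F.\<close>

lemma normalized_weight_transfer:
  assumes "finite K" "finite K'" and T: "T \<subseteq> K" "T' \<subseteq> K'"
    and up: "\<And>F G. F \<in> T \<Longrightarrow> G \<in> K \<Longrightarrow> F \<subseteq> G \<Longrightarrow> G \<in> T"
    and up': "\<And>F G. F \<in> T' \<Longrightarrow> G \<in> K' \<Longrightarrow> F \<subseteq> G \<Longrightarrow> G \<in> T'"
    and bij: "bij_betw ((`) h) T' T" and inj: "inj_on h (\<Union>T')" and "F \<in> T'"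
  shows "normalized_weight K' F = normalized_weight K (h ` F)"
  using \<open>F \<in> T'\<close>
proof (induction "card {G \<in> K'. F \<subset> G}" arbitrary: F rule: less_induct)
  case less
  have hT: "h ` G \<in> T" if "G \<in> T'" for G using bij that by (auto simp: bij_betw_def)
  have sub: "h ` G \<subseteq> h ` H \<longleftrightarrow> G \<subseteq> H" if "G \<in> T'" "H \<in> T'" for G H
  proof -
    have "h x \<in> h ` H \<longleftrightarrow> x \<in> H" if "x \<in> G" for x
      using that \<open>G \<in> T'\<close> \<open>H \<in> T'\<close> by (intro inj_on_image_mem_iff[OF inj]) auto
    then show ?thesis by blast
  qed
  have eq: "h ` G = h ` H \<longleftrightarrow> G = H" if "G \<in> T'" "H \<in> T'" for G H
    using sub that by (metis order_antisym order_refl)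
  have card: "card (h ` G) = card G" if "G \<in> T'" for G
    using that by (intro card_image inj_on_subset[OF inj]) auto
  have surj: "\<exists>G'\<in>T'. G = h ` G'" if "G \<in> T" for G
    using bij that by (auto simp: bij_betw_def)
  have facet: "facet K' F \<longleftrightarrow> facet K (h ` F)"
  proof
    assume F: "facet K' F"
    show "facet K (h ` F)"
      unfolding facet_def
    proof (intro conjI ballI impI)
      show "h ` F \<in> K" using hT less.prems T by blast
      fix G assume G: "G \<in> K" "h ` F \<subseteq> G"
      then have "G \<in> T" using up hT less.prems by blast
      then obtain G' where G': "G' \<in> T'" "G = h ` G'" using surj by blast
      then have "F \<subseteq> G'" using G sub less.prems by blast
      moreover have "G' \<in> K'" using G' T by blast
      ultimately have "G' = F" using F unfolding facet_def by blast
      then show "G = h ` F" using G' by simp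
    qed
  next
    assume F: "facet K (h ` F)"
    show "facet K' F"
      unfolding facet_def
    proof (intro conjI ballI impI)
      show "F \<in> K'" using less.prems T by blast
      fix G assume G: "G \<in> K'" "F \<subseteq> G"
      then have "G \<in> T'" using up' less.prems by blast
      moreover from this have "h ` G \<in> K" "h ` F \<subseteq> h ` G" using hT T G by auto
      then have "h ` G = h ` F" using F unfolding facet_def by blast
      ultimately show "G = F" using eq less.prems by blast
    qed
  qed
  have "face_degree K' (normalized_weight K') F = face_degree K (normalized_weight K) (h ` F)"
    unfolding face_degree_def
  proof (rule sum.reindex_cong[symmetric])
    let ?A = "{G \<in> K'. card G = card F + 1 \<and> F \<subset> G}"
    have A: "?A \<subseteq> T'" using up' less.prems by blast
    then show "inj_on ((`) h) ?A" using bij by (meson bij_betw_def inj_on_subset)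
    show "{G \<in> K. card G = card (h ` F) + 1 \<and> h ` F \<subset> G} = (`) h ` ?A"
    proof (intro equalityI subsetI)
      fix G assume G: "G \<in> {G \<in> K. card G = card (h ` F) + 1 \<and> h ` F \<subset> G}"
      then have "G \<in> T" using up hT less.prems by blast
      then obtain G' where G': "G' \<in> T'" "G = h ` G'" using surj by blast
      then have "F \<subset> G'" using G sub less.prems by blast
      moreover have "card G' = card F + 1" using G G' card less.prems by simp
      ultimately show "G \<in> (`) h ` ?A" using G' T by blast
    next
      fix G assume "G \<in> (`) h ` ?A"
      then obtain G' where G': "G' \<in> ?A" "G = h ` G'" by blast
      then have "G' \<in> T'" using A by blast
      moreover from this have "h ` F \<subset> h ` G'" using G' sub[of G' F] sub[of F G'] less.prems by blast
      ultimately show "G \<in> {G \<in> K. card G = card (h ` F) + 1 \<and> h ` F \<subset> G}"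
        using G' card less.prems hT T by auto
    qed
    fix G assume G: "G \<in> ?A"
    have "card {H \<in> K'. G \<subset> H} < card {H \<in> K'. F \<subset> H}"
      using G \<open>finite K'\<close> by (intro psubset_card_mono) auto
    then show "normalized_weight K (h ` G) = normalized_weight K' G"
      using less.hyps G A by auto
  qed
  moreover have "F \<in> K'" "h ` F \<in> K" using less.prems T hT by auto
  ultimately show ?case
    using assms(1,2) facet by (subst (1 2) normalized_weight.simps) simp
qed

text \<open>Agreement is required on the vertices of \<open>zs\<close> only, since the cochain on
  the duplicated complex is a pullback only locally. The scalar \<open>s\<close> will be 1 near the
  motif and -1 near its copy.\<close>

lemma coboundary_transfer:
  assumes "zs \<in> oriented_faces K' (i + 1)" "map h zs \<in> oriented_faces K (i + 1)"
    and "\<And>ys. set ys \<subseteq> set zs \<Longrightarrow> a ys = s * b (map h ys)"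
  shows "coboundary K' i a zs = s * coboundary K i b (map h zs)"
proof -
  have "set (take j zs @ drop (Suc j) zs) \<subseteq> set zs" for j
    using set_take_subset[of j zs] set_drop_subset[of "Suc j" zs] by simp
  from assms(3)[OF this]
  have "a (take j zs @ drop (Suc j) zs) = s * b (take j (map h zs) @ drop (Suc j) (map h zs))" for j
    by (simp add: take_map drop_map)
  then show ?thesis
    using assms(1,2) by (simp add: coboundary_def sum_distrib_left mult_ac del: sum.atMost_Suc)
qed

lemma coboundary_eq_0:
  assumes "\<And>ys. set ys \<subseteq> set zs \<Longrightarrow> a ys = 0"
  shows "coboundary K i a zs = 0"
proof -
  have "set (take j zs @ drop (Suc j) zs) \<subseteq> set zs" for j
    using set_take_subset[of j zs] set_drop_subset[of "Suc j" zs] by simp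
  from assms[OF this] have "a (take j zs @ drop (Suc j) zs) = 0" for j .
  then show ?thesis by (simp add: coboundary_def)
qed

text \<open>Compares the contributions of two matching parts to the pairing in
  \<open>up_laplacian_eq\<close>. The list \<open>xs\<close> is not assumed to be a face of
  \<open>T'\<close>: the faces outside both stars, where the cancellation takes place, must be
  covered too.\<close>

lemma inner_coboundary_transfer:
  assumes K: "simplicial_complex K" and K': "simplicial_complex K'"
    and T: "T \<subseteq> K" "T' \<subseteq> K'" and bij: "bij_betw ((`) h) T' T" and inj: "inj_on h (set xs \<union> \<Union>T')"
    and w: "\<And>G. G \<in> T' \<Longrightarrow> w' G = w (h ` G)"
    and f: "alternating f"
    and g: "\<And>G ys. G \<in> T' \<Longrightarrow> set ys \<subseteq> G \<Longrightarrow> g ys = s * f (map h ys)"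
  shows "(\<Sum>G\<in>T' \<inter> faces K' (i + 1).
        w' G * coboundary K' i (perm_sign xs) (orient G) * coboundary K' i g (orient G))
    = s * (\<Sum>G\<in>T \<inter> faces K (i + 1).
        w G * coboundary K i (perm_sign (map h xs)) (orient G) * coboundary K i f (orient G))"
  unfolding sum_distrib_left
proof (rule sum.reindex_cong[symmetric])
  have card: "card (h ` G) = card G" if "G \<in> T'" for G
    using that by (intro card_image inj_on_subset[OF inj]) auto
  show "inj_on ((`) h) (T' \<inter> faces K' (i + 1))"
    using bij by (meson Int_lower1 bij_betw_def inj_on_subset)
  show "T \<inter> faces K (i + 1) = (`) h ` (T' \<inter> faces K' (i + 1))"
    using bij T card unfolding faces_def bij_betw_def by auto
  fix G assume G: "G \<in> T' \<inter> faces K' (i + 1)"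
  define zs where "zs = orient G"
  have zs: "distinct zs" "set zs = G" "zs \<in> oriented_faces K' (i + 1)"
    using G orient_faces[OF K'] unfolding zs_def by blast+
  have hG: "h ` G \<in> faces K (i + 1)"
    using G bij T card unfolding faces_def bij_betw_def by auto
  have inj': "inj_on h (set xs \<union> set ys)" if "set ys \<subseteq> G" for ys
    using G that by (intro inj_on_subset[OF inj]) auto
  have "distinct (map h zs)"
    using zs inj'[of zs] by (simp add: distinct_map inj_on_Un)
  then have hzs: "map h zs \<in> oriented_faces K (i + 1)"
    using hG zs by (simp add: oriented_faces_def)
  have "coboundary K' i (perm_sign xs) zs = 1 * coboundary K i (perm_sign (map h xs)) (map h zs)"
    using zs inj' by (intro coboundary_transfer hzs) (simp_all add: perm_sign_map)
  moreover have "coboundary K' i g zs = s * coboundary K i f (map h zs)"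
    using zs g G by (intro coboundary_transfer hzs) auto
  \<comment> \<open>The transported orientation of G need not be the one chosen by
    \<open>orient\<close> for its image; the product of two alternating functions does not see the
    difference.\<close>
  moreover have "coboundary K i (perm_sign (map h xs)) (map h zs) * coboundary K i f (map h zs)
      = coboundary K i (perm_sign (map h xs)) (orient (h ` G)) * coboundary K i f (orient (h ` G))"
    using \<open>distinct (map h zs)\<close> orient_faces[OF K hG] zs
    by (intro alternating_mult_cong alternating_coboundary alternating_perm_sign f) auto
  ultimately show "s * (w (h ` G) * coboundary K i (perm_sign (map h xs)) (orient (h ` G)) *
        coboundary K i f (orient (h ` G)))
      = w' G * coboundary K' i (perm_sign xs) (orient G) * coboundary K' i g (orient G)"
    using w G by (simp add: zs_def)
qed

section \<open>Duplication of a motif\<close>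

context
  fixes K \<Sigma> :: "'a set set" and V' :: "'a set" and \<rho> :: "'a \<Rightarrow> 'a"
  assumes K: "simplicial_complex K" and \<Sigma>: "subcomplex \<Sigma> K" and nv: "new_vertices K \<Sigma> V' \<rho>"
begin

private abbreviation (input) "\<phi> \<equiv> unprime V' \<rho>"
private abbreviation (input) "T \<equiv> star K \<Sigma>"
private abbreviation (input) "K' \<equiv> duplication K \<Sigma> V' \<rho>"
private abbreviation (input) "T' \<equiv> star K' (motif_copy \<Sigma> V' \<rho>)"

text \<open>\<Sigma> contains each of its vertices as a face, so having a nonempty face in \<Sigma>
  amounts to meeting its vertex set. In this form upward closure is evident.\<close>

lemma star_iff: "F \<in> T \<longleftrightarrow> F \<in> K \<and> F \<inter> \<Union>\<Sigma> \<noteq> {}"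
proof -
  have "{v} \<in> \<Sigma>" if "v \<in> \<Union>\<Sigma>" for v
    using \<Sigma> that unfolding subcomplex_def simplicial_complex_def by blast
  then show ?thesis
    unfolding star_def by blast
qed

lemma disjoint_vertices:
  shows "V' \<inter> \<Union>K = {}" "\<Union>\<Sigma> \<subseteq> \<Union>K" "V' \<inter> \<Union>\<Sigma> = {}"
  using nv \<Sigma> unfolding new_vertices_def subcomplex_def by blast+

lemma link_subset: "link K \<Sigma> \<subseteq> K"
  using K unfolding link_def closure_in_def subcomplex_def star_def by blast

text \<open>A face of the link through a vertex of \<Sigma> would lie in the star of the closure of
  \<Sigma>, which the link excludes.\<close>

lemma link_disjoint: "\<Union>(link K \<Sigma>) \<inter> \<Union>\<Sigma> = {}"
proof (rule ccontr)
  assume "\<not> ?thesis"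
  then obtain F v where F: "F \<in> link K \<Sigma>" "v \<in> F" "v \<in> \<Union>\<Sigma>" by blast
  then have "F \<in> T" using link_subset star_iff by blast
  moreover have "\<Sigma> \<subseteq> closure_in K \<Sigma>" unfolding closure_in_def by blast
  ultimately have "F \<in> star K (closure_in K \<Sigma>)" unfolding star_def by blast
  with F show False unfolding link_def by blast
qed

text \<open>Removing the vertices of \<Sigma> from F leaves a face of the closed star with no
  nonempty face in \<Sigma>, that is, a face of the link. Hence duplication copies every face of the
  star.\<close>

lemma star_subset_link:
  assumes F: "F \<in> T"
  shows "F \<subseteq> \<Union>\<Sigma> \<union> \<Union>(link K \<Sigma>)"
proof -
  have "F - \<Union>\<Sigma> \<in> closure_in K T"
    using F unfolding closure_in_def subcomplex_def simplicial_complex_def by blast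
  moreover have "closure_in K \<Sigma> \<subseteq> \<Sigma>" using \<Sigma> unfolding closure_in_def by blast
  then have "F - \<Union>\<Sigma> \<notin> star K (closure_in K \<Sigma>)" unfolding star_def by blast
  ultimately show ?thesis unfolding link_def by blast
qed

lemma unprime_image: "\<phi> ` V' = \<Union>\<Sigma>"
  using nv unfolding new_vertices_def bij_betw_def unprime_def by force

lemma unprime_old [simp]: "x \<notin> V' \<Longrightarrow> \<phi> x = x"
  by (simp add: unprime_def)

lemma unprime_image_old: "F \<inter> V' = {} \<Longrightarrow> \<phi> ` F = F"
  by (force simp: unprime_def)

text \<open>Once the originals are removed, \<open>unprime\<close> hits a vertex of \<Sigma> exactly
  from the new vertices, so old and new points cannot collide.\<close>

lemma inj_unprime: "inj_on \<phi> (- \<Union>\<Sigma>)"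
proof (rule inj_onI)
  fix x y assume xy: "x \<in> - \<Union>\<Sigma>" "y \<in> - \<Union>\<Sigma>" "\<phi> x = \<phi> y"
  have "\<phi> z \<in> \<Union>\<Sigma> \<longleftrightarrow> z \<in> V'" if "z \<in> - \<Union>\<Sigma>" for z
    using that unprime_image by (cases "z \<in> V'") auto
  with xy have "x \<in> V' \<longleftrightarrow> y \<in> V'" by metis
  then show "x = y"
    using xy nv unfolding new_vertices_def bij_betw_def unprime_def by (auto dest: inj_onD)
qed

lemma duplication_iff:
  "F \<in> K' \<longleftrightarrow> F \<in> K \<or> F \<subseteq> V' \<union> \<Union>(link K \<Sigma>) \<and> \<phi> ` F \<in> K"
  by (auto simp: duplication_def)

lemma simplicial_complex_duplication: "simplicial_complex K'"
proof -
  have fin: "finite (\<Union>K)" using K unfolding simplicial_complex_def by blast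
  have "finite (\<Union>\<Sigma>)" using finite_subset[OF disjoint_vertices(2) fin] .
  then have "finite V'" using nv unfolding new_vertices_def by (metis bij_betw_finite)
  moreover have "finite (\<Union>(link K \<Sigma>))" using finite_subset[OF Union_mono[OF link_subset] fin] .
  moreover have "K' \<subseteq> Pow (\<Union>K \<union> V' \<union> \<Union>(link K \<Sigma>))" unfolding duplication_def by blast
  ultimately have fin': "finite (\<Union>K \<union> V' \<union> \<Union>(link K \<Sigma>))" "finite K'"
    using fin by (auto intro: finite_subset)
  have "finite F" if "F \<in> K'" for F
    using that \<open>K' \<subseteq> _\<close> finite_subset[OF _ fin'(1), of F] by blast
  moreover have "G \<in> K'" if "F \<in> K'" "G \<subseteq> F" for F G
    using that K image_mono[OF that(2), of \<phi>] unfolding duplication_iff simplicial_complex_def by blast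
  moreover have "{} \<in> K'" using K unfolding duplication_iff simplicial_complex_def by blast
  ultimately show ?thesis using fin' unfolding simplicial_complex_def by blast
qed

lemma star_copy_iff: "F \<in> T' \<longleftrightarrow> F \<in> K' \<and> F \<inter> V' \<noteq> {}"
proof -
  have "{v} \<in> motif_copy \<Sigma> V' \<rho>" if "v \<in> V'" for v
  proof -
    have "\<rho> v \<in> \<Union>\<Sigma>" using nv that unfolding new_vertices_def bij_betw_def by blast
    then have "{\<rho> v} \<in> \<Sigma>" using \<Sigma> unfolding subcomplex_def simplicial_complex_def by blast
    then show ?thesis using that by (simp add: motif_copy_def)
  qed
  then show ?thesis
    unfolding star_def motif_copy_def by blast
qed

text \<open>A face with a new vertex is not in K, so it stems from the second part of the
  duplication and has only new and link vertices. This keeps the copy apart from the motif.\<close>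

lemma star_copyD:
  assumes "F \<in> T'"
  shows "F \<subseteq> V' \<union> \<Union>(link K \<Sigma>)" "\<phi> ` F \<in> T" "F \<inter> \<Union>\<Sigma> = {}" "F \<notin> K"
proof -
  have F: "F \<inter> V' \<noteq> {}" "F \<in> K'" using assms star_copy_iff by blast+
  then show "F \<notin> K" using disjoint_vertices by blast
  then show sub: "F \<subseteq> V' \<union> \<Union>(link K \<Sigma>)" using F duplication_iff by blast
  have "\<phi> ` F \<in> K" using F \<open>F \<notin> K\<close> duplication_iff by blast
  then show "\<phi> ` F \<in> T" using F unprime_image star_iff by blast
  show "F \<inter> \<Union>\<Sigma> = {}" using sub link_disjoint disjoint_vertices by blast
qed

text \<open>Faces added by the duplication have only new and link vertices and so avoid the motif.
  Thus the faces of the star gain no cofaces.\<close>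

lemma star_duplication:
  assumes "F \<in> K'" "F \<inter> \<Union>\<Sigma> \<noteq> {}"
  shows "F \<in> T"
proof -
  have "\<not> F \<subseteq> V' \<union> \<Union>(link K \<Sigma>)" using assms(2) disjoint_vertices(3) link_disjoint by blast
  then show ?thesis using assms unfolding duplication_iff star_iff by blast
qed

lemma bij_star: "bij_betw ((`) \<phi>) T' T"
  unfolding bij_betw_def
proof
  show "inj_on ((`) \<phi>) T'"
    by (intro inj_on_image inj_on_subset[OF inj_unprime]) (use star_copyD in blast)
  show "(`) \<phi> ` T' = T"
  proof
    show "(`) \<phi> ` T' \<subseteq> T" using star_copyD by blast
    show "T \<subseteq> (`) \<phi> ` T'"
    proof
      fix F assume F: "F \<in> T"
      \<comment> \<open>The preimage replaces the vertices of F in the motif by their copies and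
        keeps the other vertices.\<close>
      define G where "G = {v \<in> V'. \<phi> v \<in> F} \<union> (F - \<Union>\<Sigma>)"
      have FK: "F \<in> K" "F \<inter> \<Union>\<Sigma> \<noteq> {}" using F star_iff by blast+
      have "\<phi> ` (F - \<Union>\<Sigma>) = F - \<Union>\<Sigma>"
        using FK disjoint_vertices by (intro unprime_image_old) blast
      moreover have "\<phi> ` {v \<in> V'. \<phi> v \<in> F} = F \<inter> \<Union>\<Sigma>"
        by (auto simp flip: unprime_image)
      ultimately have GF: "\<phi> ` G = F" by (auto simp: G_def image_Un)
      have "G \<subseteq> V' \<union> \<Union>(link K \<Sigma>)"
        using star_subset_link[OF F] unfolding G_def by blast
      then have "G \<in> K'" using GF FK by (simp add: duplication_iff)
      moreover have "G \<inter> V' \<noteq> {}"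
      proof -
        obtain v where "v \<in> F" "v \<in> \<Union>\<Sigma>" using FK by blast
        then obtain u where "u \<in> V'" "\<phi> u \<in> F" using unprime_image by (metis imageE)
        then show ?thesis by (auto simp: G_def)
      qed
      ultimately have "G \<in> T'" by (simp add: star_copy_iff)
      then show "F \<in> (`) \<phi> ` T'" using GF by (intro image_eqI[of _ _ G]) simp_all
    qed
  qed
qed

text \<open>The transfer along the identity from the star to itself; \<open>star_duplication\<close>
  supplies its upward closure in the larger complex.\<close>

lemma normalized_weight_star:
  assumes "F \<in> T"
  shows "normalized_weight K' F = normalized_weight K F"
proof -
  have "normalized_weight K' F = normalized_weight K (id ` F)"
  proof (rule normalized_weight_transfer[of K K' T T])
    show "finite K" "finite K'" using K simplicial_complex_duplication by (auto simp: simplicial_complex_def)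
    show "T \<subseteq> K" "T \<subseteq> K'" unfolding star_def duplication_def by blast+
    show "G \<in> T" if "F \<in> T" "G \<in> K" "F \<subseteq> G" for F G
      using that star_iff by blast
    show "G \<in> T" if "F \<in> T" "G \<in> K'" "F \<subseteq> G" for F G
      using that star_iff star_duplication by blast
    show "bij_betw ((`) id) T T" by (simp add: image_id[abs_def] bij_betw_def inj_on_def)
  qed (use assms in auto)
  then show ?thesis by simp
qed

lemma normalized_weight_star_copy:
  assumes "F \<in> T'"
  shows "normalized_weight K' F = normalized_weight K (\<phi> ` F)"
proof (rule normalized_weight_transfer[of K K' T T'])
  show "finite K" "finite K'" using K simplicial_complex_duplication by (auto simp: simplicial_complex_def)
  show "T \<subseteq> K" "T' \<subseteq> K'" unfolding star_def by blast+
  show "G \<in> T" if "F \<in> T" "G \<in> K" "F \<subseteq> G" for F G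
    using that star_iff by blast
  show "G \<in> T'" if "F \<in> T'" "G \<in> K'" "F \<subseteq> G" for F G
    using that star_copy_iff by blast
  show "inj_on \<phi> (\<Union>T')" by (rule inj_on_subset[OF inj_unprime]) (use star_copyD in blast)
qed (use assms bij_star in auto)

text \<open>The guard in \<open>g\<close> is essential: \<open>unprime\<close> fixes old vertices,
  so an unguarded difference would vanish on the star of the motif as well. By locality the
  Laplacian of \<open>g\<close> splits into one sum over each star, and each sum is the matching one
  for \<open>f\<close> in K up to sign.\<close>

lemma eigenfunction_duplication:
  assumes f: "f \<in> cochains K i" and supp: "\<And>xs. set xs \<notin> T \<Longrightarrow> f xs = 0" and nz: "f \<noteq> (\<lambda>_. 0)"
    and eig: "\<And>xs. xs \<in> oriented_faces K i \<Longrightarrow> set xs \<in> T \<Longrightarrow> up_laplacian K i f xs = c * f xs"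
  defines "g \<equiv> (\<lambda>xs. f xs - (if set xs \<in> T' then f (map \<phi> xs) else 0))"
  shows "eigenfunction_up_laplacian K' i c g"
proof -
  let ?w = "normalized_weight K" and ?w' = "normalized_weight K'"
  note K' = simplicial_complex_duplication
  have alt: "alternating f" using f by (simp add: cochains_iff)
  have old: "F \<notin> T'" if "F \<in> K" for F using that star_copyD(4) by blast
  have TK: "T \<subseteq> K" "T \<subseteq> K'" "T' \<subseteq> K'" unfolding star_def duplication_def by blast+
  have subK: "F \<in> K" if "G \<in> K" "F \<subseteq> G" for F G using K that unfolding simplicial_complex_def by blast
  have subK': "F \<in> K'" if "G \<in> K'" "F \<subseteq> G" for F G using K' that unfolding simplicial_complex_def by blast
  have g_star: "g ys = 1 * f (map id ys)" if "G \<in> T" "set ys \<subseteq> G" for G ys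
  proof -
    have "set ys \<in> K" using that subK TK(1) by blast
    then show ?thesis using old by (simp add: g_def)
  qed
  \<comment> \<open>A subface of G without new vertices lies outside both stars, since G avoids the
    motif. There \<open>unprime\<close> acts trivially and both sides are 0.\<close>
  have g_copy: "g ys = - 1 * f (map \<phi> ys)" if "G \<in> T'" "set ys \<subseteq> G" for G ys
  proof (cases "set ys \<in> T'")
    case True
    have "set ys \<notin> T" using star_copyD(4)[OF True] TK(1) by blast
    then have "f ys = 0" by (rule supp)
    then show ?thesis using True by (simp add: g_def)
  next
    case False
    then have "set ys \<inter> V' = {}" using star_copy_iff subK' that TK by blast
    then have "map \<phi> ys = ys" by (intro map_idI unprime_old) blast
    moreover have "set ys \<notin> T" using star_copyD(3)[OF that(1)] that(2) star_iff by blast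
    then have "f ys = 0" by (rule supp)
    ultimately show ?thesis using False by (simp add: g_def)
  qed
  \<comment> \<open>Both stars are upward closed, so a subface of a face outside them is outside
    them too.\<close>
  have g_other: "g ys = 0" if "G \<notin> T" "G \<notin> T'" "G \<in> K'" "set ys \<subseteq> G" for G ys
  proof -
    have "set ys \<notin> T'" using that star_copy_iff by blast
    moreover have "set ys \<notin> T" using that star_iff star_duplication by blast
    ultimately show ?thesis using supp by (simp add: g_def)
  qed
  have g_alt: "alternating g"
  proof (rule alternating_if_permute_list)
    fix xs :: "'a list" and p assume p: "p permutes {..<length xs}"
    have "f (permute_list p (map \<phi> xs)) = of_int (sign p) * f (map \<phi> xs)"
      using p by (intro alternating_permute_list alt) simp
    then show "g (permute_list p xs) = of_int (sign p) * g xs"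
      using alternating_permute_list[OF alt p] p
      by (simp add: g_def permute_list_map[symmetric] algebra_simps)
  qed
  have g_supp: "g xs = 0" if xs: "xs \<notin> oriented_faces K' i" for xs
  proof -
    have "xs \<notin> oriented_faces K i"
      using xs unfolding oriented_faces_def faces_def duplication_def by blast
    moreover have "map \<phi> xs \<notin> oriented_faces K i" if T': "set xs \<in> T'"
    proof -
      have "inj_on \<phi> (set xs)" by (rule inj_on_subset[OF inj_unprime]) (use star_copyD(3)[OF T'] in blast)
      then have "card (\<phi> ` set xs) = card (set xs)" by (rule card_image)
      then show ?thesis
        using xs T' TK unfolding oriented_faces_def faces_def by (auto simp: distinct_map)
    qed
    ultimately show ?thesis using f by (simp add: g_def cochains_iff)
  qed
  have g: "g \<in> cochains K' i" using g_alt g_supp by (simp add: cochains_iff)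
  have "g \<noteq> (\<lambda>_. 0)"
  proof -
    obtain xs where xs: "f xs \<noteq> 0" using nz by blast
    then have "set xs \<in> T" using supp[of xs] by argo
    then have "g xs = f xs" using g_star by fastforce
    with xs show ?thesis by metis
  qed
  \<comment> \<open>\<open>P\<close> collects all that K contributes, because the coboundary of
    \<open>f\<close> vanishes outside the star. \<open>Q\<close> is the same sum in the duplicated
    complex over a chosen part.\<close>
  define P where "P xs = (\<Sum>G\<in>T \<inter> faces K (i + 1).
      ?w G * coboundary K i (perm_sign xs) (orient G) * coboundary K i f (orient G))" for xs
  define Q where "Q S xs = (\<Sum>G\<in>S \<inter> faces K' (i + 1).
      ?w' G * coboundary K' i (perm_sign xs) (orient G) * coboundary K' i g (orient G))" for S xs
  have P: "?w (set xs) * up_laplacian K i f xs = P xs" if xs: "xs \<in> oriented_faces K i" for xs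
    unfolding up_laplacian_eq[OF K xs] inner_cochains_def P_def
  proof (intro sum.mono_neutral_right ballI)
    fix G assume G: "G \<in> faces K (i + 1) - T \<inter> faces K (i + 1)"
    have "coboundary K i f (orient G) = 0"
      using G orient_faces(2)[OF K, of G "i + 1"] star_iff
      by (intro coboundary_eq_0 supp) (auto simp: faces_def)
    then show "?w G * coboundary K i (perm_sign xs) (orient G) * coboundary K i f (orient G) = 0" by simp
  qed (auto intro: finite_faces[OF K])
  have Q: "?w' (set xs) * up_laplacian K' i g xs = Q T xs + Q T' xs" if xs: "xs \<in> oriented_faces K' i" for xs
  proof -
    have "?w' (set xs) * up_laplacian K' i g xs = Q (T \<union> T') xs"
      unfolding up_laplacian_eq[OF K' xs] inner_cochains_def Q_def
    proof (intro sum.mono_neutral_right ballI)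
      fix G assume G: "G \<in> faces K' (i + 1) - (T \<union> T') \<inter> faces K' (i + 1)"
      have "coboundary K' i g (orient G) = 0"
        using G orient_faces(2)[OF K', of G "i + 1"] g_other[of G]
        by (intro coboundary_eq_0) (auto simp: faces_def)
      then show "?w' G * coboundary K' i (perm_sign xs) (orient G) * coboundary K' i g (orient G) = 0" by simp
    qed (auto intro: finite_faces[OF K'])
    also have "\<dots> = Q T xs + Q T' xs"
      unfolding Q_def Int_Un_distrib2 using finite_faces[OF K'] old TK
      by (intro sum.union_disjoint) auto
    finally show ?thesis .
  qed
  have QT: "Q T xs = P xs" for xs
    using inner_coboundary_transfer[of K K' T T id xs ?w' ?w f g 1 i] K K' TK alt g_star normalized_weight_star
    by (simp add: Q_def P_def image_id[abs_def] bij_betw_def inj_on_def)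
  \<comment> \<open>Avoiding the motif keeps \<open>unprime\<close> injective on
    \<open>set xs\<close> together with all vertices of the star of the copy.\<close>
  have QT': "Q T' xs = - P (map \<phi> xs)" if "set xs \<inter> \<Union>\<Sigma> = {}" for xs
  proof -
    have "inj_on \<phi> (set xs \<union> \<Union>T')"
      by (rule inj_on_subset[OF inj_unprime]) (use that star_copyD(3) in blast)
    from inner_coboundary_transfer[where w = ?w and w' = ?w' and f = f and g = g and s = "- 1" and i = i,
        OF K K' TK(1,3) bij_star this normalized_weight_star_copy alt g_copy]
    show ?thesis by (simp add: Q_def P_def)
  qed
  have Q0: "Q S xs = 0" if "\<And>G. G \<in> S \<Longrightarrow> \<not> set xs \<subseteq> G" for S xs
    unfolding Q_def
  proof (intro sum.neutral ballI)
    fix G assume G: "G \<in> S \<inter> faces K' (i + 1)"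
    have "coboundary K' i (perm_sign xs) (orient G) = 0"
      using G orient_faces(2)[OF K', of G "i + 1"] that[of G]
      by (intro coboundary_eq_0 perm_sign_eq_0) auto
    then show "?w' G * coboundary K' i (perm_sign xs) (orient G) * coboundary K' i g (orient G) = 0" by simp
  qed
  have "up_laplacian K' i g xs = c * g xs" for xs
  proof (cases "xs \<in> oriented_faces K' i")
    case False
    then show ?thesis using g up_laplacian_cochain[OF K'] by (simp add: cochains_iff)
  next
    case xs: True
    then have d: "distinct xs" "set xs \<in> K'" "card (set xs) = i + 1"
      by (auto simp: oriented_faces_def faces_def)
    have "?w' (set xs) * up_laplacian K' i g xs = ?w' (set xs) * (c * g xs)"
    proof -
      consider "set xs \<in> T" | "set xs \<in> T'" | "set xs \<notin> T" "set xs \<notin> T'" by blast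
      then show ?thesis
      proof cases
        case 1
        then have xsK: "xs \<in> oriented_faces K i" using d TK by (auto simp: oriented_faces_def faces_def)
        have "set xs \<inter> \<Union>\<Sigma> \<noteq> {}" using 1 star_iff by blast
        \<comment> \<open>No face contains both a vertex of the motif and a new one, so on either
          star the other star contributes nothing.\<close>
        then have "Q T' xs = 0" using star_copyD(3) by (intro Q0) blast
        then show ?thesis
          using Q[OF xs] QT P[OF xsK, symmetric] eig[OF xsK 1] g_star[OF 1, of xs] normalized_weight_star[OF 1]
          by simp
      next
        case 2
        have inj: "inj_on \<phi> (set xs)" by (rule inj_on_subset[OF inj_unprime]) (use star_copyD(3)[OF 2] in blast)
        then have xsK: "map \<phi> xs \<in> oriented_faces K i"
          using d TK star_copyD(2)[OF 2] card_image[OF inj] by (auto simp: oriented_faces_def faces_def distinct_map)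
        have "set (map \<phi> xs) \<in> T" using star_copyD(2)[OF 2] by simp
        note e = eig[OF xsK this]
        have "\<not> set xs \<subseteq> G" if "G \<in> T" for G
        proof -
          have "G \<inter> V' = {}" using that TK(1) disjoint_vertices(1) by blast
          moreover have "set xs \<inter> V' \<noteq> {}" using 2 star_copy_iff by blast
          ultimately show ?thesis by blast
        qed
        then have "Q T xs = 0" by (rule Q0)
        then show ?thesis
          using Q[OF xs] QT'[OF star_copyD(3)[OF 2]] P[OF xsK, symmetric] e g_copy[OF 2, of xs]
            normalized_weight_star_copy[OF 2]
          by simp
      next
        case 3
        then have "set xs \<inter> V' = {}" "set xs \<inter> \<Union>\<Sigma> = {}"
          using d star_copy_iff star_duplication by blast+
        moreover from this have "map \<phi> xs = xs" by (intro map_idI unprime_old) blast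
        \<comment> \<open>Here \<open>unprime\<close> fixes \<open>xs\<close>, so the copy
          contributes exactly the negative of what the motif does.\<close>
        ultimately have "Q T' xs = - P xs" using QT'[of xs] by simp
        moreover have "g xs = 0" using g_other[OF 3 d(2), of xs] by simp
        ultimately show ?thesis using Q[OF xs] QT by simp
      qed
    qed
    then show ?thesis using normalized_weight_pos[OF K' d(2)] by simp
  qed
  with g \<open>g \<noteq> _\<close> show ?thesis unfolding eigenfunction_up_laplacian_def by blast
qed

end

lemma linearly_independent_nonzero:
  assumes "linearly_independent n f" "j < n"
  shows "f j \<noteq> (\<lambda>_. 0)"
proof
  assume "f j = (\<lambda>_. 0)"
  then have "(\<Sum>k<n. of_bool (k = j) * f k x) = 0" for x
    by (auto intro!: sum.neutral simp: fun_eq_iff)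
  then have "of_bool (j = j) = (0 :: real)"
    using assms unfolding linearly_independent_def by (elim allE[of _ "\<lambda>k. of_bool (k = j)"]) blast
  then show False by simp
qed

theorem theorem6p10:
  fixes K \<Sigma> :: "'a set set" and i n :: nat
  assumes "simplicial_complex K"
    and "motif K i \<Sigma>"
    and "n = card {F \<in> star K \<Sigma>. card F = i + 1}"
  shows "\<exists>(f :: nat \<Rightarrow> 'a list \<Rightarrow> real) (c :: nat \<Rightarrow> real).
     (\<forall>j<n. f j \<in> cochains K i) \<and>
     linearly_independent n f \<and>
     (\<forall>j<n. \<forall>xs\<in>oriented_faces K i. set xs \<in> star K \<Sigma> \<longrightarrow>
        up_laplacian K i (f j) xs = c j * f j xs) \<and>
     (\<forall>V' \<rho>. new_vertices K \<Sigma> V' \<rho> \<longrightarrow>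
       (let K' = duplication K \<Sigma> V' \<rho>; \<Sigma>' = motif_copy \<Sigma> V' \<rho> in
        \<exists>g :: nat \<Rightarrow> 'a list \<Rightarrow> real. \<forall>j<n.
          eigenfunction_up_laplacian K' i (c j) (g j) \<and>
          (\<forall>xs\<in>oriented_faces K' i.
             (set xs \<in> star K \<Sigma> \<longrightarrow> g j xs = f j xs) \<and>
             (set xs \<in> star K' \<Sigma>' \<longrightarrow> g j xs = - f j (map (unprime V' \<rho>) xs)) \<and>
             (set xs \<notin> star K \<Sigma> \<and> set xs \<notin> star K' \<Sigma>' \<longrightarrow> g j xs = 0))))"
proof -
  define S where "S = {F \<in> star K \<Sigma>. card F = i + 1}"
  have \<Sigma>: "subcomplex \<Sigma> K" using assms(2) by (simp add: motif_def)
  have "S \<subseteq> faces K i" by (auto simp: S_def faces_def star_def)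
  from eigenfunctions_on_faces[OF assms(1) this] obtain f c
    where coch: "\<And>j. j < n \<Longrightarrow> f j \<in> cochains K i"
      and supp: "\<And>j xs. j < n \<Longrightarrow> set xs \<notin> S \<Longrightarrow> f j xs = 0"
      and lin: "linearly_independent n f"
      and eig: "\<And>j xs. j < n \<Longrightarrow> xs \<in> oriented_faces K i \<Longrightarrow> set xs \<in> S \<Longrightarrow>
        up_laplacian K i (f j) xs = c j * f j xs"
    unfolding S_def assms(3)[symmetric] by blast
  have supp': "f j xs = 0" if "j < n" "set xs \<notin> star K \<Sigma>" for j xs
    using supp that by (simp add: S_def)
  have eig': "up_laplacian K i (f j) xs = c j * f j xs"
    if "j < n" "xs \<in> oriented_faces K i" "set xs \<in> star K \<Sigma>" for j xs
    using eig that by (simp add: S_def oriented_faces_def faces_def)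
  \<comment> \<open>\<open>f\<close> and \<open>c\<close> are fixed before the new vertices are
    chosen; only \<open>g\<close> depends on \<open>V'\<close> and \<rho>.\<close>
  have "\<exists>g. \<forall>j<n. eigenfunction_up_laplacian (duplication K \<Sigma> V' \<rho>) i (c j) (g j) \<and>
      (\<forall>xs\<in>oriented_faces (duplication K \<Sigma> V' \<rho>) i.
         (set xs \<in> star K \<Sigma> \<longrightarrow> g j xs = f j xs) \<and>
         (set xs \<in> star (duplication K \<Sigma> V' \<rho>) (motif_copy \<Sigma> V' \<rho>) \<longrightarrow> g j xs = - f j (map (unprime V' \<rho>) xs)) \<and>
         (set xs \<notin> star K \<Sigma> \<and> set xs \<notin> star (duplication K \<Sigma> V' \<rho>) (motif_copy \<Sigma> V' \<rho>) \<longrightarrow> g j xs = 0))"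
    if nv: "new_vertices K \<Sigma> V' \<rho>" for V' \<rho>
  proof -
    let ?T' = "star (duplication K \<Sigma> V' \<rho>) (motif_copy \<Sigma> V' \<rho>)"
    have disj: "F \<notin> star K \<Sigma>" if "F \<in> ?T'" for F
      using star_copyD(4)[OF assms(1) \<Sigma> nv that] by (simp add: star_def)
    show ?thesis
    proof (intro exI[of _ "\<lambda>j xs. f j xs -
          (if set xs \<in> ?T' then f j (map (unprime V' \<rho>) xs) else 0)"] allI impI conjI ballI)
      fix j assume j: "j < n"
      show "eigenfunction_up_laplacian (duplication K \<Sigma> V' \<rho>) i (c j)
         (\<lambda>xs. f j xs - (if set xs \<in> ?T' then f j (map (unprime V' \<rho>) xs) else 0))"
        by (rule eigenfunction_duplication[OF assms(1) \<Sigma> nv coch[OF j] supp'[OF j]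
            linearly_independent_nonzero[OF lin j] eig'[OF j]])
    qed (use disj supp' in auto)
  qed
  then show ?thesis
    using coch lin eig' unfolding Let_def by blast
qed

end
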